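(* Let $K$ be one of $\mathcal{M}(\mathbf{C})$, $\mathbf{C}(\{z\})$ (convergent case) or $\mathbf{C}((z))$ (formal case). Let $u=d\,z^{\nu}v$ with $d\in\mathbf{C}^*$, $\nu\in\mathbf{Z}$, $v\in K$, $v(0)=1$, and let $\overline{d}$ denote the class of $d$ modulo $q^{\mathbf{Z}}$. Then the $\mathbf{C}$-linear operator $\sigma_q-u:K\to K$, $f\mapsto\sigma_q(f)-uf$, has an index (its kernel and cokernel are finite-dimensional over $\mathbf{C}$), and the dimension of its kernel, the dimension of its cokernel, and its index are as follows: - if $\nu=0$ and $\overline{d}=1$: kernel $1$, cokernel $1$, index $0$; - if $\nu=0$ and $\overline{d}\neq1$: kernel $0$, cokernel $0$, index $0$; - if $\nu>0$ ($d$ arbitrary): kernel $0$, cokernel $0$, index $0$; - if $\nu<0$ ($d$ arbitrary): kernel $0$; in the formal case cokernel $0$ and index $0$; in the convergent case cokernel $-\nu$ and index $\nu$.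
   Context: Fix $q\in\mathbf{C}$ with $|q|>1$. $\mathcal{M}(\mathbf{C})$ is the field of meromorphic functions on $\mathbf{C}$, $\mathbf{C}(\{z\})$ the field of germs of meromorphic functions at $0$, $\mathbf{C}((z))$ the field of formal Laurent series, and $\sigma_q:f(z)\mapsto f(qz)$. The index of a $\mathbf{C}$-linear map with finite-dimensional kernel and cokernel is $\dim\ker-\dim\operatorname{coker}$. The condition $\overline{d}=1$ means $d\in q^{\mathbf{Z}}$. *)

theory Defs
  imports
    "HOL-Complex_Analysis.Complex_Analysis"
    "HOL-Algebra.AbelCoset"
    "Jordan_Normal_Form.VS_Connect"
begin

section \<open>Meromorphic functions and germs of meromorphic functions\<close>

(* Functions in the library are total, so a function that is meromorphic on A has irrelevant values
   at its poles (and may have irrelevant values at a discrete set of further points). Elements of the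
   two fields below are therefore classes of the following partial equivalence relation. For A = {0}
   the relation is equality on a punctured neighbourhood of 0, so the classes are the germs at 0; for
   A = UNIV it is equality outside a closed discrete set. *)
definition mero_rel :: "complex set \<Rightarrow> (complex \<Rightarrow> complex) \<Rightarrow> (complex \<Rightarrow> complex) \<Rightarrow> bool" where
  "mero_rel A f g \<longleftrightarrow>
     f meromorphic_on A \<and> g meromorphic_on A \<and> (\<forall>z\<in>A. \<forall>\<^sub>F w in at z. f w = g w)"

lemma mero_rel_refl: "f meromorphic_on A \<Longrightarrow> mero_rel A f f"
  by (simp add: mero_rel_def)

lemma part_equivp_mero_rel: "part_equivp (mero_rel A)"
proof (rule part_equivpI)
  show "\<exists>x. mero_rel A x x"
    by (rule exI[of _ "\<lambda>_. 0"]) (auto simp: mero_rel_def intro: meromorphic_intros)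
  show "symp (mero_rel A)"
    by (auto simp: symp_def mero_rel_def eq_commute)
  show "transp (mero_rel A)"
    unfolding transp_def mero_rel_def
  proof (intro allI impI conjI ballI; (elim conjE)?)
    fix f g h :: "complex \<Rightarrow> complex" and z
    assume "\<forall>z\<in>A. \<forall>\<^sub>F w in at z. f w = g w" "\<forall>z\<in>A. \<forall>\<^sub>F w in at z. g w = h w" "z \<in> A"
    then have "\<forall>\<^sub>F w in at z. f w = g w" "\<forall>\<^sub>F w in at z. g w = h w" by auto
    then show "\<forall>\<^sub>F w in at z. f w = h w" by eventually_elim simp
  qed auto
qed

lemma mero_rel_op2:
  assumes "mero_rel A f f'" "mero_rel A g g'"
    and "\<And>f g. f meromorphic_on A \<Longrightarrow> g meromorphic_on A \<Longrightarrow> (\<lambda>z. h (f z) (g z)) meromorphic_on A"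
  shows "mero_rel A (\<lambda>z. h (f z) (g z)) (\<lambda>z. h (f' z) (g' z))"
  unfolding mero_rel_def
proof (intro conjI ballI)
  fix z assume "z \<in> A"
  then have "\<forall>\<^sub>F w in at z. f w = f' w" "\<forall>\<^sub>F w in at z. g w = g' w"
    using assms(1,2) by (auto simp: mero_rel_def)
  then show "\<forall>\<^sub>F w in at z. h (f w) (g w) = h (f' w) (g' w)"
    by eventually_elim simp
qed (use assms in \<open>auto simp: mero_rel_def\<close>)

lemma mero_rel_add: "mero_rel A f f' \<Longrightarrow> mero_rel A g g' \<Longrightarrow>
    mero_rel A (\<lambda>z. f z + g z) (\<lambda>z. f' z + g' z)"
  by (rule mero_rel_op2) (auto intro: meromorphic_intros)

lemma mero_rel_diff: "mero_rel A f f' \<Longrightarrow> mero_rel A g g' \<Longrightarrow>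
    mero_rel A (\<lambda>z. f z - g z) (\<lambda>z. f' z - g' z)"
  by (rule mero_rel_op2) (auto intro: meromorphic_intros)

lemma mero_rel_mult: "mero_rel A f f' \<Longrightarrow> mero_rel A g g' \<Longrightarrow>
    mero_rel A (\<lambda>z. f z * g z) (\<lambda>z. f' z * g' z)"
  by (rule mero_rel_op2) (auto intro: meromorphic_intros)

lemma mero_rel_divide: "mero_rel A f f' \<Longrightarrow> mero_rel A g g' \<Longrightarrow>
    mero_rel A (\<lambda>z. f z / g z) (\<lambda>z. f' z / g' z)"
  by (rule mero_rel_op2) (auto intro: meromorphic_intros)

lemma mero_rel_uminus: "mero_rel A f f' \<Longrightarrow> mero_rel A (\<lambda>z. - (f z)) (\<lambda>z. - (f' z))"
  by (rule mero_rel_op2[where h = "\<lambda>x _. - x"]) (auto intro: meromorphic_intros)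

lemma mero_rel_inverse: "mero_rel A f f' \<Longrightarrow> mero_rel A (\<lambda>z. inverse (f z)) (\<lambda>z. inverse (f' z))"
  by (rule mero_rel_op2[where h = "\<lambda>x _. inverse x"]) (auto intro: meromorphic_intros)

lemma eventually_at_scale:
  fixes q z :: complex
  assumes "q \<noteq> 0" "eventually P (at (q * z))"
  shows   "eventually (\<lambda>w. P (q * w)) (at z)"
proof -
  have "filterlim (\<lambda>w. q * w) (at (q * z)) (at z)"
    using assms(1) by (auto simp: filterlim_at eventually_at_filter intro!: tendsto_intros)
  then show ?thesis
    using assms(2) by (simp add: filterlim_iff)
qed

(* The substitution z |-> q z, given the junk value 0 for q = 0, where it would not be well-defined
   on functions with a pole at 0. *)
lemma mero_rel_scale:
  assumes "mero_rel A f g" "\<And>z. z \<in> A \<Longrightarrow> q * z \<in> A"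
  shows   "mero_rel A (\<lambda>z. if q = 0 then 0 else f (q * z)) (\<lambda>z. if q = 0 then 0 else g (q * z))"
proof (cases "q = 0")
  case True
  then show ?thesis by (auto simp: mero_rel_def intro: meromorphic_intros)
next
  case False
  have "(\<lambda>z. h (q * z)) meromorphic_on A" if "h meromorphic_on A" for h
    by (rule meromorphic_on_compose[OF that]) (use assms(2) in \<open>auto intro!: analytic_intros\<close>)
  then show ?thesis
    using False assms by (auto simp: mero_rel_def intro!: eventually_at_scale)
qed

quotient_type mero = "complex \<Rightarrow> complex" / partial: "mero_rel UNIV"
  by (rule part_equivp_mero_rel)

quotient_type mero_germ = "complex \<Rightarrow> complex" / partial: "mero_rel {0}"
  by (rule part_equivp_mero_rel)

lemma mero_rel_UNIV_nonzero:
  assumes "f meromorphic_on UNIV" "\<not> mero_rel UNIV f (\<lambda>_. 0)"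
  shows   "mero_rel UNIV (\<lambda>z. inverse (f z) * f z) (\<lambda>_. 1)"
proof -
  have "\<not> eventually (\<lambda>z. f z = 0) (cosparse UNIV)"
    using assms by (auto simp: mero_rel_def eventually_cosparse_open_eq intro: meromorphic_intros)
  then have "eventually (\<lambda>z. f z \<noteq> 0) (cosparse UNIV)"
    using meromorphic_imp_constant_or_avoid[OF assms(1), of 0] by auto
  then show ?thesis
    using assms(1)
    by (auto simp: mero_rel_def eventually_cosparse_open_eq
             intro!: meromorphic_intros intro: eventually_mono)
qed

lemma mero_rel_0_nonzero:
  assumes "f meromorphic_on {0}" "\<not> mero_rel {0} f (\<lambda>_. 0)"
  shows   "mero_rel {0} (\<lambda>z. inverse (f z) * f z) (\<lambda>_. 1)"
proof -
  have "\<not> eventually (\<lambda>z. f z = 0) (at 0)"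
    using assms by (auto simp: mero_rel_def intro: meromorphic_intros)
  then have "eventually (\<lambda>z. f z \<noteq> 0) (at 0)"
    using assms(1) non_zero_neighbour[of f 0]
    by (auto simp: meromorphic_at_iff frequently_def)
  then show ?thesis
    using assms(1)
    by (auto simp: mero_rel_def intro!: meromorphic_intros elim!: eventually_mono)
qed

instantiation mero :: field
begin

lift_definition zero_mero :: mero is "\<lambda>_. 0" by (auto intro: mero_rel_refl meromorphic_intros)
lift_definition one_mero :: mero is "\<lambda>_. 1" by (auto intro: mero_rel_refl meromorphic_intros)
lift_definition plus_mero :: "mero \<Rightarrow> mero \<Rightarrow> mero" is "\<lambda>f g z. f z + g z" by (rule mero_rel_add)
lift_definition minus_mero :: "mero \<Rightarrow> mero \<Rightarrow> mero" is "\<lambda>f g z. f z - g z" by (rule mero_rel_diff)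
lift_definition uminus_mero :: "mero \<Rightarrow> mero" is "\<lambda>f z. - f z" by (rule mero_rel_uminus)
lift_definition times_mero :: "mero \<Rightarrow> mero \<Rightarrow> mero" is "\<lambda>f g z. f z * g z" by (rule mero_rel_mult)
lift_definition inverse_mero :: "mero \<Rightarrow> mero" is "\<lambda>f z. inverse (f z)" by (rule mero_rel_inverse)
lift_definition divide_mero :: "mero \<Rightarrow> mero \<Rightarrow> mero" is "\<lambda>f g z. f z / g z" by (rule mero_rel_divide)

instance
proof
  fix a b c :: mero
  show "a + b + c = a + (b + c)"
    by transfer (auto simp: mero_rel_def add_ac intro!: meromorphic_intros)
  show "a + b = b + a"
    by transfer (auto simp: mero_rel_def add_ac intro!: meromorphic_intros)
  show "0 + a = a" by transfer (auto simp: mero_rel_def)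
  show "- a + a = 0" by transfer (auto simp: mero_rel_def intro!: meromorphic_intros)
  show "a - b = a + - b" by transfer (auto simp: mero_rel_def intro!: meromorphic_intros)
  show "a * b * c = a * (b * c)"
    by transfer (auto simp: mero_rel_def mult_ac intro!: meromorphic_intros)
  show "a * b = b * a"
    by transfer (auto simp: mero_rel_def mult_ac intro!: meromorphic_intros)
  show "1 * a = a" by transfer (auto simp: mero_rel_def)
  show "(a + b) * c = a * c + b * c"
    by transfer (auto simp: mero_rel_def algebra_simps intro!: meromorphic_intros)
  show "(0::mero) \<noteq> 1" by transfer (auto simp: mero_rel_def)
  show "a \<noteq> 0 \<Longrightarrow> inverse a * a = 1"
    by transfer (rule mero_rel_UNIV_nonzero, auto simp: mero_rel_def)
  show "a div b = a * inverse b"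
    by transfer (auto simp: mero_rel_def divide_inverse intro!: meromorphic_intros)
  show "inverse (0::mero) = 0" by transfer (auto simp: mero_rel_def intro!: meromorphic_intros)
qed

end

instantiation mero_germ :: field
begin

lift_definition zero_mero_germ :: mero_germ is "\<lambda>_. 0"
  by (auto intro: mero_rel_refl meromorphic_intros)
lift_definition one_mero_germ :: mero_germ is "\<lambda>_. 1"
  by (auto intro: mero_rel_refl meromorphic_intros)
lift_definition plus_mero_germ :: "mero_germ \<Rightarrow> mero_germ \<Rightarrow> mero_germ" is "\<lambda>f g z. f z + g z"
  by (rule mero_rel_add)
lift_definition minus_mero_germ :: "mero_germ \<Rightarrow> mero_germ \<Rightarrow> mero_germ" is "\<lambda>f g z. f z - g z"
  by (rule mero_rel_diff)
lift_definition uminus_mero_germ :: "mero_germ \<Rightarrow> mero_germ" is "\<lambda>f z. - f z"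
  by (rule mero_rel_uminus)
lift_definition times_mero_germ :: "mero_germ \<Rightarrow> mero_germ \<Rightarrow> mero_germ" is "\<lambda>f g z. f z * g z"
  by (rule mero_rel_mult)
lift_definition inverse_mero_germ :: "mero_germ \<Rightarrow> mero_germ" is "\<lambda>f z. inverse (f z)"
  by (rule mero_rel_inverse)
lift_definition divide_mero_germ :: "mero_germ \<Rightarrow> mero_germ \<Rightarrow> mero_germ" is "\<lambda>f g z. f z / g z"
  by (rule mero_rel_divide)

instance
proof
  fix a b c :: mero_germ
  show "a + b + c = a + (b + c)"
    by transfer (auto simp: mero_rel_def add_ac intro!: meromorphic_intros)
  show "a + b = b + a"
    by transfer (auto simp: mero_rel_def add_ac intro!: meromorphic_intros)
  show "0 + a = a" by transfer (auto simp: mero_rel_def)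
  show "- a + a = 0" by transfer (auto simp: mero_rel_def intro!: meromorphic_intros)
  show "a - b = a + - b" by transfer (auto simp: mero_rel_def intro!: meromorphic_intros)
  show "a * b * c = a * (b * c)"
    by transfer (auto simp: mero_rel_def mult_ac intro!: meromorphic_intros)
  show "a * b = b * a"
    by transfer (auto simp: mero_rel_def mult_ac intro!: meromorphic_intros)
  show "1 * a = a" by transfer (auto simp: mero_rel_def)
  show "(a + b) * c = a * c + b * c"
    by transfer (auto simp: mero_rel_def algebra_simps intro!: meromorphic_intros)
  show "(0::mero_germ) \<noteq> 1" by transfer (auto simp: mero_rel_def)
  show "a \<noteq> 0 \<Longrightarrow> inverse a * a = 1"
    by transfer (rule mero_rel_0_nonzero, auto simp: mero_rel_def)
  show "a div b = a * inverse b"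
    by transfer (auto simp: mero_rel_def divide_inverse intro!: meromorphic_intros)
  show "inverse (0::mero_germ) = 0" by transfer (auto simp: mero_rel_def intro!: meromorphic_intros)
qed

end

lift_definition mero_const :: "complex \<Rightarrow> mero" is "\<lambda>c _. c"
  by (auto intro: mero_rel_refl meromorphic_intros)
lift_definition mero_z :: mero is "\<lambda>z. z"
  by (auto intro: mero_rel_refl meromorphic_intros)
lift_definition mero_sigma :: "complex \<Rightarrow> mero \<Rightarrow> mero"
  is "\<lambda>q f z. if q = 0 then 0 else f (q * z)"
  by (rule mero_rel_scale) auto

lift_definition germ_const :: "complex \<Rightarrow> mero_germ" is "\<lambda>c _. c"
  by (auto intro: mero_rel_refl meromorphic_intros)
lift_definition germ_z :: mero_germ is "\<lambda>z. z"
  by (auto intro: mero_rel_refl meromorphic_intros)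
lift_definition germ_sigma :: "complex \<Rightarrow> mero_germ \<Rightarrow> mero_germ"
  is "\<lambda>q f z. if q = 0 then 0 else f (q * z)"
  by (rule mero_rel_scale) auto

(* "No pole at 0, and value c there". For a class of functions the value at 0 is the limit, since
   the value at 0 of a representative is irrelevant. *)
lift_definition mero_value0 :: "mero \<Rightarrow> complex \<Rightarrow> bool" is "\<lambda>f c. f \<midarrow>0\<rightarrow> c"
proof -
  fix f g :: "complex \<Rightarrow> complex"
  assume "mero_rel UNIV f g"
  then have "\<forall>\<^sub>F w in at 0. f w = g w" by (auto simp: mero_rel_def)
  then show "(\<lambda>c. f \<midarrow>0\<rightarrow> c) = (\<lambda>c. g \<midarrow>0\<rightarrow> c)" by (intro ext tendsto_cong)
qed

lift_definition germ_value0 :: "mero_germ \<Rightarrow> complex \<Rightarrow> bool" is "\<lambda>f c. f \<midarrow>0\<rightarrow> c"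
proof -
  fix f g :: "complex \<Rightarrow> complex"
  assume "mero_rel {0} f g"
  then have "\<forall>\<^sub>F w in at 0. f w = g w" by (auto simp: mero_rel_def)
  then show "(\<lambda>c. f \<midarrow>0\<rightarrow> c) = (\<lambda>c. g \<midarrow>0\<rightarrow> c)" by (intro ext tendsto_cong)
qed


section \<open>Formal Laurent series\<close>

definition formal_sigma :: "complex \<Rightarrow> complex fls \<Rightarrow> complex fls" where
  "formal_sigma q f = fls_compose_fps f (fps_const q * fps_X)"

lemma fls_nth_formal_sigma: "q \<noteq> 0 \<Longrightarrow> fls_nth (formal_sigma q f) n = q powi n * fls_nth f n"
  unfolding formal_sigma_def by (subst fls_nth_fls_compose_fps_linear) (simp_all add: mult.commute)

definition formal_value0 :: "complex fls \<Rightarrow> complex \<Rightarrow> bool" where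
  "formal_value0 f c \<longleftrightarrow> fls_subdegree f \<ge> 0 \<and> fls_nth f 0 = c"


section \<open>Kernel, cokernel and index of a linear endomorphism\<close>

(* An extension field of the complex numbers, embedded by c, as a complex vector space. *)
definition cspace :: "(complex \<Rightarrow> 'a::field) \<Rightarrow> (complex, 'a) module" where
  "cspace c = \<lparr>carrier = UNIV, mult = (*), one = 1, zero = 0, add = (+), smult = (\<lambda>a x. c a * x)\<rparr>"

(* The quotient space V / W. A module record inherits the fields mult and one from ring records;
   they play no role for modules and get dummy values. *)
definition quot_space :: "('k, 'a) module \<Rightarrow> 'a set \<Rightarrow> ('k, 'a set) module" where
  "quot_space V W = \<lparr>carrier = a_rcosets\<^bsub>V\<^esub> W, mult = (\<lambda>_ _. W), one = W, zero = W, add = set_add V,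
     smult = (\<lambda>a X. \<Union>x\<in>X. W +>\<^bsub>V\<^esub> (a \<odot>\<^bsub>V\<^esub> x))\<rparr>"

lemma vectorspace_cspace:
  assumes "c 1 = 1" "\<And>a b. c (a + b) = c a + c b" "\<And>a b. c (a * b) = c a * c b"
  shows   "vectorspace class_ring (cspace c)"
proof (rule vs_criteria)
  show "field (class_ring :: complex ring)" by (rule class_field)
  show "\<forall>v\<in>carrier (cspace c). \<exists>n\<in>carrier (cspace c). v \<oplus>\<^bsub>cspace c\<^esub> n = \<zero>\<^bsub>cspace c\<^esub>"
    by (simp add: cspace_def) (metis add.right_inverse)
qed (use assms in \<open>simp_all add: cspace_def distrib_left distrib_right add_ac mult_ac\<close>)

lemma vectorspace_quot_space:
  assumes "subspace K W V"
  shows   "vectorspace K (quot_space V W)"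
proof -
  interpret vs: vectorspace K V using assms by (simp add: subspace_def)
  interpret sm: submodule K W V using assms by (simp add: subspace_def)
  have sub: "abelian_subgroup W V"
  proof (rule abelian_subgroupI3)
    show "additive_subgroup W V"
    proof (rule additive_subgroup.intro, rule subgroup.intro)
      fix x assume x: "x \<in> W"
      have "(\<ominus>\<^bsub>K\<^esub> \<one>\<^bsub>K\<^esub>) \<odot>\<^bsub>V\<^esub> x \<in> W" using x by simp
      moreover have "(\<ominus>\<^bsub>K\<^esub> \<one>\<^bsub>K\<^esub>) \<odot>\<^bsub>V\<^esub> x = \<ominus>\<^bsub>V\<^esub> x"
        by (rule vs.smult_minus_1) (use x sm.subset in blast)
      ultimately have "\<ominus>\<^bsub>V\<^esub> x \<in> W" by metis
      then show "inv\<^bsub>add_monoid V\<^esub> x \<in> W" by (simp add: a_inv_def)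
    qed (use sm.subset in auto)
    show "abelian_group V" ..
  qed
  interpret W: abelian_subgroup W V by (rule sub)
  have cos: "X \<in> carrier (quot_space V W) \<longleftrightarrow> (\<exists>x\<in>carrier V. X = W +>\<^bsub>V\<^esub> x)" for X
    by (auto simp: quot_space_def A_RCOSETS_def')
  have add: "(W +>\<^bsub>V\<^esub> x) \<oplus>\<^bsub>quot_space V W\<^esub> (W +>\<^bsub>V\<^esub> y) = W +>\<^bsub>V\<^esub> (x \<oplus>\<^bsub>V\<^esub> y)"
    if "x \<in> carrier V" "y \<in> carrier V" for x y
    using W.a_rcos_sum that by (simp add: quot_space_def)
  have zero: "\<zero>\<^bsub>quot_space V W\<^esub> = W +>\<^bsub>V\<^esub> \<zero>\<^bsub>V\<^esub>"
    using sm.subset by (simp add: quot_space_def)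
  have smult: "a \<odot>\<^bsub>quot_space V W\<^esub> (W +>\<^bsub>V\<^esub> x) = W +>\<^bsub>V\<^esub> (a \<odot>\<^bsub>V\<^esub> x)"
    if a: "a \<in> carrier K" and x: "x \<in> carrier V" for a x
  proof -
    have "W +>\<^bsub>V\<^esub> (a \<odot>\<^bsub>V\<^esub> y) = W +>\<^bsub>V\<^esub> (a \<odot>\<^bsub>V\<^esub> x)" if y: "y \<in> W +>\<^bsub>V\<^esub> x" for y
    proof -
      obtain w where w: "w \<in> W" "y = w \<oplus>\<^bsub>V\<^esub> x" using y by (auto simp: a_r_coset_def')
      then have "a \<odot>\<^bsub>V\<^esub> y = a \<odot>\<^bsub>V\<^esub> w \<oplus>\<^bsub>V\<^esub> a \<odot>\<^bsub>V\<^esub> x"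
        using a x sm.subset by (auto simp: vs.smult_r_distr)
      then have "a \<odot>\<^bsub>V\<^esub> y \<in> W +>\<^bsub>V\<^esub> (a \<odot>\<^bsub>V\<^esub> x)"
        using w a by (auto simp: a_r_coset_def')
      then show ?thesis by (rule abelian_subgroup.a_repr_independence'[OF sub, symmetric]) (rule vs.smult_closed[OF a x])
    qed
    moreover have "W +>\<^bsub>V\<^esub> x \<noteq> {}"
    proof -
      have "x \<in> W +>\<^bsub>V\<^esub> x" using x by (rule abelian_subgroup.a_rcos_self[OF sub])
      then show ?thesis by blast
    qed
    ultimately have "(\<Union>y\<in>W +>\<^bsub>V\<^esub> x. W +>\<^bsub>V\<^esub> (a \<odot>\<^bsub>V\<^esub> y)) = W +>\<^bsub>V\<^esub> (a \<odot>\<^bsub>V\<^esub> x)"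
      by (intro SUP_eq_const)
    then show ?thesis by (simp add: quot_space_def)
  qed
  show ?thesis
  proof (rule vs_criteria)
    show "field K" ..
    show "\<forall>X\<in>carrier (quot_space V W). \<exists>Y\<in>carrier (quot_space V W).
            X \<oplus>\<^bsub>quot_space V W\<^esub> Y = \<zero>\<^bsub>quot_space V W\<^esub>"
    proof
      fix X assume "X \<in> carrier (quot_space V W)"
      then obtain x where x: "x \<in> carrier V" "X = W +>\<^bsub>V\<^esub> x" using cos by auto
      then have "X \<oplus>\<^bsub>quot_space V W\<^esub> (W +>\<^bsub>V\<^esub> (\<ominus>\<^bsub>V\<^esub> x)) = \<zero>\<^bsub>quot_space V W\<^esub>"
        by (simp add: add zero vs.M.r_neg)
      then show "\<exists>Y\<in>carrier (quot_space V W). X \<oplus>\<^bsub>quot_space V W\<^esub> Y = \<zero>\<^bsub>quot_space V W\<^esub>"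
        using x cos by blast
    qed
    show "\<zero>\<^bsub>quot_space V W\<^esub> \<in> carrier (quot_space V W)"
      by (auto simp: cos zero)
    show "\<forall>X Y. X \<in> carrier (quot_space V W) \<and> Y \<in> carrier (quot_space V W) \<longrightarrow>
            X \<oplus>\<^bsub>quot_space V W\<^esub> Y \<in> carrier (quot_space V W)"
      unfolding cos using add vs.M.add.m_closed by metis
    show "\<forall>a X. a \<in> carrier K \<and> X \<in> carrier (quot_space V W) \<longrightarrow>
            a \<odot>\<^bsub>quot_space V W\<^esub> X \<in> carrier (quot_space V W)"
      unfolding cos using smult vs.smult_closed by metis
    show "\<forall>X Y. X \<in> carrier (quot_space V W) \<and> Y \<in> carrier (quot_space V W) \<longrightarrow>
            X \<oplus>\<^bsub>quot_space V W\<^esub> Y = Y \<oplus>\<^bsub>quot_space V W\<^esub> X"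
      unfolding cos using add vs.M.a_comm by metis
    show "\<forall>X Y Z. X \<in> carrier (quot_space V W) \<and> Y \<in> carrier (quot_space V W) \<and>
            Z \<in> carrier (quot_space V W) \<longrightarrow>
            X \<oplus>\<^bsub>quot_space V W\<^esub> Y \<oplus>\<^bsub>quot_space V W\<^esub> Z =
            X \<oplus>\<^bsub>quot_space V W\<^esub> (Y \<oplus>\<^bsub>quot_space V W\<^esub> Z)"
      by (clarsimp simp: cos add vs.M.a_assoc)
    show "\<forall>X\<in>carrier (quot_space V W). X \<oplus>\<^bsub>quot_space V W\<^esub> \<zero>\<^bsub>quot_space V W\<^esub> = X"
      by (clarsimp simp: cos add zero)
    show "\<forall>a b X. a \<in> carrier K \<and> b \<in> carrier K \<and> X \<in> carrier (quot_space V W) \<longrightarrow>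
            (a \<otimes>\<^bsub>K\<^esub> b) \<odot>\<^bsub>quot_space V W\<^esub> X =
            a \<odot>\<^bsub>quot_space V W\<^esub> (b \<odot>\<^bsub>quot_space V W\<^esub> X)"
      by (clarsimp simp: cos smult vs.smult_assoc1)
    show "\<forall>X\<in>carrier (quot_space V W). \<one>\<^bsub>K\<^esub> \<odot>\<^bsub>quot_space V W\<^esub> X = X"
      by (clarsimp simp: cos smult)
    show "\<forall>a b X. a \<in> carrier K \<and> b \<in> carrier K \<and> X \<in> carrier (quot_space V W) \<longrightarrow>
            (a \<oplus>\<^bsub>K\<^esub> b) \<odot>\<^bsub>quot_space V W\<^esub> X =
            a \<odot>\<^bsub>quot_space V W\<^esub> X \<oplus>\<^bsub>quot_space V W\<^esub> b \<odot>\<^bsub>quot_space V W\<^esub> X"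
      by (clarsimp simp: cos add smult vs.smult_l_distr)
    show "\<forall>a X Y. a \<in> carrier K \<and> X \<in> carrier (quot_space V W) \<and>
            Y \<in> carrier (quot_space V W) \<longrightarrow>
            a \<odot>\<^bsub>quot_space V W\<^esub> (X \<oplus>\<^bsub>quot_space V W\<^esub> Y) =
            a \<odot>\<^bsub>quot_space V W\<^esub> X \<oplus>\<^bsub>quot_space V W\<^esub> a \<odot>\<^bsub>quot_space V W\<^esub> Y"
      by (clarsimp simp: cos add smult vs.smult_r_distr)
  qed
qed

lemma vectorspace_mero: "vectorspace class_ring (cspace mero_const)"
  by (rule vectorspace_cspace; transfer)
    (auto simp: mero_rel_def intro!: meromorphic_intros)

lemma vectorspace_germ: "vectorspace class_ring (cspace germ_const)"
  by (rule vectorspace_cspace; transfer)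
    (auto simp: mero_rel_def intro!: meromorphic_intros)

lemma vectorspace_formal: "vectorspace class_ring (cspace (fls_const :: complex \<Rightarrow> complex fls))"
  by (rule vectorspace_cspace) (simp_all add: fls_plus_const fls_const_mult_const)

definition ker_space :: "(complex, 'a) module \<Rightarrow> ('a \<Rightarrow> 'a) \<Rightarrow> (complex, 'a) module" where
  "ker_space V T = V\<lparr>carrier := mod_hom.ker V V T\<rparr>"

definition coker_space :: "(complex, 'a) module \<Rightarrow> ('a \<Rightarrow> 'a) \<Rightarrow> (complex, 'a set) module" where
  "coker_space V T = quot_space V (mod_hom.im V T)"

definition dim_ker :: "(complex, 'a) module \<Rightarrow> ('a \<Rightarrow> 'a) \<Rightarrow> nat" where
  "dim_ker V T = vectorspace.dim class_ring (ker_space V T)"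

definition dim_coker :: "(complex, 'a) module \<Rightarrow> ('a \<Rightarrow> 'a) \<Rightarrow> nat" where
  "dim_coker V T = vectorspace.dim class_ring (coker_space V T)"

definition has_index :: "(complex, 'a) module \<Rightarrow> ('a \<Rightarrow> 'a) \<Rightarrow> bool" where
  "has_index V T \<longleftrightarrow> linear_map class_ring V V T \<and>
     vectorspace.fin_dim class_ring (ker_space V T) \<and>
     vectorspace.fin_dim class_ring (coker_space V T)"

definition op_index :: "(complex, 'a) module \<Rightarrow> ('a \<Rightarrow> 'a) \<Rightarrow> int" where
  "op_index V T = int (dim_ker V T) - int (dim_coker V T)"

end

(* All three fields embed, by Laurent expansion at 0, into the field of formal Laurent series, with
   images everything, the convergent series, and the expansions of functions meromorphic on the
   plane. The q-difference equation w(qz) = v(z) w(z) has a solution w with w(0) = 1 in each field,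
   and f = w h turns the operator for u = d z^nu v into v w times the operator for d z^nu, whose
   action on coefficients is the two-term recurrence q^n h_n - d h_(n - nu). For nu >= 0 solving
   it upwards preserves convergence. For nu < 0 it produces growth of order q^(n^2/(2|nu|)), and one
   convergence condition in each residue class of degrees modulo |nu| accounts for the cokernel. On
   the plane nothing new happens: a local solution of f(qz) = u(z) f(z) + g(z) continues along
   z -> q z. *)

theory Submission
  imports Defs
begin

text \<open>The image of \<open>mero\<close> among the Laurent series is not given by a growth bound
  on coefficients, so estimates cannot be made inside it. All three fields therefore enter through
  one closure property: a series in a possibly larger set \<open>D\<close> that solves a first-order
  equation with coefficients in the field lies in the field. Both the gauge factor \<open>w\<close>
  and a preimage \<open>w * h\<close> are found in \<open>D\<close> and solve such equations; for
  \<open>w * h\<close> the inhomogeneity is the given element minus its chosen complement term.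
  Dimensions come from exponents: \<open>qop_bases\<close> names monomials spanning the kernel and a
  complement of the image of the monomial operator, and multiplication by \<open>w\<close>,
  respectively \<open>v * w\<close>, carries them to bases in the field. Convergence is always a
  bound C * R^n with R \<ge> 1, never an exact radius, since the factors q^n decide every estimate:
  dividing by them improves such a bound, multiplying by them destroys it. Hence for \<nu> > 0 the
  recurrence is solved from low to high degree, but for \<nu> < 0, in high degrees, from infinity
  downwards.\<close>

section \<open>Dimensions of kernel and cokernel from explicit bases\<close>

lemma finsum_cspace:
  assumes "vectorspace class_ring (cspace c)" "finite B"
  shows "finsum (cspace c) g B = sum g B"
proof -
  interpret vectorspace class_ring "cspace c" by fact
  have [simp]: "carrier (cspace c) = UNIV" "add (cspace c) = (+)" "zero (cspace c) = 0"
    by (simp_all add: cspace_def)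
  show ?thesis
    using assms(2) by (induction B rule: finite_induct) simp_all
qed

lemma lincomb_cspace:
  assumes "vectorspace class_ring (cspace c)" "finite B"
  shows "module.lincomb (cspace c) a B = (\<Sum>b\<in>B. c (a b) * b)"
proof -
  interpret vectorspace class_ring "cspace c" by fact
  show ?thesis
    unfolding lincomb_def using assms by (simp add: finsum_cspace) (simp add: cspace_def)
qed

lemma (in vectorspace) finite_basisI:
  assumes "finite B" "B \<subseteq> carrier V"
    and span: "\<And>v. v \<in> carrier V \<Longrightarrow> \<exists>a\<in>B \<rightarrow> carrier K. v = lincomb a B"
    and indep: "\<And>a. a \<in> B \<rightarrow> carrier K \<Longrightarrow> lincomb a B = \<zero>\<^bsub>V\<^esub> \<Longrightarrow> \<forall>b\<in>B. a b = \<zero>\<^bsub>K\<^esub>"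
  shows "fin_dim" "dim = card B"
proof -
  have gen: "gen_set B"
    using span span_is_subset2[OF assms(2)] finite_span[OF assms(1,2)] by blast
  then show fin_dim
    using assms(1,2) by (auto simp: fin_dim_def)
  have "lin_indpt B"
    by (rule finite_lin_indpt2[OF assms(1,2)]) (use indep in blast)
  with gen assms(2) have "basis B" by (simp add: basis_def)
  with assms(1) show "dim = card B" by (rule dim_basis)
qed

lemma linear_map_cspace_iff:
  assumes "vectorspace class_ring (cspace c)"
  shows "linear_map class_ring (cspace c) (cspace c) T \<longleftrightarrow>
    (\<forall>x y. T (x + y) = T x + T y) \<and> (\<forall>a x. T (c a * x) = c a * T x)"
  using assms
  by (auto simp: linear_map_def mod_hom_def mod_hom_axioms_def module_hom_def vectorspace_def)
     (simp_all add: cspace_def)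

locale cspace_op =
  fixes c :: "complex \<Rightarrow> 'a::field" and T :: "'a \<Rightarrow> 'a"
  assumes vs: "vectorspace class_ring (cspace c)"
    and T_add: "T (x + y) = T x + T y"
    and T_smult: "T (c a * x) = c a * T x"
begin

sublocale V: vectorspace class_ring "cspace c"
  by (rule vs)

sublocale T: linear_map class_ring "cspace c" "cspace c" T
  using linear_map_cspace_iff[OF vs] T_add T_smult by blast

lemma T_0 [simp]: "T 0 = 0"
  using T_add[of 0 0] by (metis add_cancel_right_right)

lemma T_uminus: "T (- x) = - T x"
  using T_add[of x "- x"] by (simp add: add_eq_0_iff)

lemma T_diff: "T (x - y) = T x - T y"
  using T_add[of x "- y"] by (simp add: T_uminus)

lemma ker_eq: "T.ker = {x. T x = 0}"
  by (auto simp: T.ker_def) (auto simp: cspace_def)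

lemma im_eq: "T.im = range T"
  by (auto simp: T.im_def) (auto simp: cspace_def)

text \<open>The scalar action on the element 1 of the field is \<open>c\<close> itself, so the
  properties of \<open>c\<close> are instances of module axioms.\<close>

lemma c_add: "c (a + b) = c a + c b"
  using V.smult_l_distr[of a b 1] by (simp add: cspace_def)

lemma c_0 [simp]: "c 0 = 0"
  using c_add[of 0 0] by (metis add_cancel_right_right)

lemma c_1 [simp]: "c 1 = 1"
  using V.smult_one[of 1] by (simp add: cspace_def)

lemma c_uminus: "c (- a) = - c a"
  using c_add[of a "- a"] by (simp add: add_eq_0_iff)

lemma ker_spaceI:
  assumes "finite B" "\<And>b. b \<in> B \<Longrightarrow> T b = 0"
    and span: "\<And>x. T x = 0 \<Longrightarrow> \<exists>a. x = (\<Sum>b\<in>B. c (a b) * b)"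
    and indep: "\<And>a. (\<Sum>b\<in>B. c (a b) * b) = 0 \<Longrightarrow> \<forall>b\<in>B. a b = 0"
  shows "vectorspace.fin_dim class_ring (ker_space (cspace c) T)" "dim_ker (cspace c) T = card B"
proof -
  interpret ker: vectorspace class_ring "ker_space (cspace c) T"
    unfolding ker_space_def by (rule V.subspace_is_vs) (rule T.kerT_is_subspace)
  have car: "carrier (ker_space (cspace c) T) = {x. T x = 0}"
    by (simp add: ker_space_def ker_eq)
  have lc: "ker.lincomb a B = (\<Sum>b\<in>B. c (a b) * b)" for a
  proof -
    have "V.lincomb a B = ker.lincomb a B"
      unfolding ker_space_def 
      by (rule V.lincomb_not_depend) (use assms T.kerT_is_subspace in \<open>auto simp: subspace_def ker_eq\<close>)
    then show ?thesis
      using lincomb_cspace[OF vs assms(1)] by simp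
  qed
  have z: "\<zero>\<^bsub>ker_space (cspace c) T\<^esub> = 0"
    by (simp add: ker_space_def cspace_def)
  have "ker.fin_dim \<and> ker.dim = card B"
    by (intro conjI ker.finite_basisI)
       (use assms in \<open>auto simp: car lc z\<close>)
  then show "vectorspace.fin_dim class_ring (ker_space (cspace c) T)" "dim_ker (cspace c) T = card B"
    by (auto simp: dim_ker_def)
qed

lemma coset_cspace: "W +>\<^bsub>cspace c\<^esub> x = (\<lambda>w. w + x) ` W"
  by (auto simp: a_r_coset_def r_coset_def cspace_def)

lemma coset_eq_iff: "range T +>\<^bsub>cspace c\<^esub> x = range T +>\<^bsub>cspace c\<^esub> y \<longleftrightarrow> x - y \<in> range T"
proof
  assume "range T +>\<^bsub>cspace c\<^esub> x = range T +>\<^bsub>cspace c\<^esub> y"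
  moreover have "x \<in> range T +>\<^bsub>cspace c\<^esub> x"
    unfolding coset_cspace by (rule image_eqI[of _ _ 0]) (auto intro: image_eqI[of _ _ 0])
  ultimately obtain w where "x = T w + y" by (auto simp: coset_cspace)
  then show "x - y \<in> range T" by auto
next
  assume "x - y \<in> range T"
  then obtain w where w: "x = T w + y" by (metis diff_add_cancel imageE)
  have "T v + x = T (v + w) + y" "T v + y = T (v - w) + x" for v
    by (simp_all add: w T_add T_diff)
  then have "T v + x \<in> (\<lambda>w. w + y) ` range T" "T v + y \<in> (\<lambda>w. w + x) ` range T" for v
    by (metis rangeI imageI)+
  then show "range T +>\<^bsub>cspace c\<^esub> x = range T +>\<^bsub>cspace c\<^esub> y"
    unfolding coset_cspace by blast
qed

lemma coset_hom:
  "mod_hom class_ring (cspace c) (coker_space (cspace c) T) (\<lambda>x. range T +>\<^bsub>cspace c\<^esub> x)"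
proof -
  interpret coker: vectorspace class_ring "coker_space (cspace c) T"
    unfolding coker_space_def by (rule vectorspace_quot_space) (rule T.imT_is_subspace)
  have add: "range T +>\<^bsub>cspace c\<^esub> (x + y) =
      (range T +>\<^bsub>cspace c\<^esub> x) <+>\<^bsub>cspace c\<^esub> (range T +>\<^bsub>cspace c\<^esub> y)" for x y
  proof (intro subset_antisym subsetI)
    fix z assume "z \<in> range T +>\<^bsub>cspace c\<^esub> (x + y)"
    \<comment> \<open>Since \<open>T 0 = 0\<close>, the summand \<open>T 0 + y\<close> is
      \<open>y\<close> displayed as an element of its own coset.\<close>
    then obtain v where v: "z = (T v + x) + (T 0 + y)" by (auto simp: coset_cspace)
    have "T v + x \<in> range T +>\<^bsub>cspace c\<^esub> x" "T 0 + y \<in> range T +>\<^bsub>cspace c\<^esub> y"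
      unfolding coset_cspace by blast+
    moreover have "z = (T v + x) \<oplus>\<^bsub>cspace c\<^esub> (T 0 + y)"
      by (simp add: v cspace_def)
    ultimately show "z \<in> (range T +>\<^bsub>cspace c\<^esub> x) <+>\<^bsub>cspace c\<^esub> (range T +>\<^bsub>cspace c\<^esub> y)"
      unfolding set_add_def' by blast
  next
    fix z assume "z \<in> (range T +>\<^bsub>cspace c\<^esub> x) <+>\<^bsub>cspace c\<^esub> (range T +>\<^bsub>cspace c\<^esub> y)"
    then obtain v w where "z = T (v + w) + (x + y)"
      by (auto simp: coset_cspace set_add_def' T_add) (auto simp: cspace_def add_ac)
    then show "z \<in> range T +>\<^bsub>cspace c\<^esub> (x + y)"
      unfolding coset_cspace by blast
  qed
  have smult: "(\<Union>y\<in>range T +>\<^bsub>cspace c\<^esub> x. range T +>\<^bsub>cspace c\<^esub> (c a * y)) =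
      range T +>\<^bsub>cspace c\<^esub> (c a * x)" for a x
  proof -
    have "range T +>\<^bsub>cspace c\<^esub> (c a * y) = range T +>\<^bsub>cspace c\<^esub> (c a * x)"
      if y: "y \<in> range T +>\<^bsub>cspace c\<^esub> x" for y
    proof -
      obtain w where "y = T w + x" using y by (auto simp: coset_cspace)
      then have "c a * y - c a * x = T (c a * w)" unfolding T_smult by (simp add: distrib_left)
      then show ?thesis by (simp add: coset_eq_iff)
    qed
    moreover have "range T +>\<^bsub>cspace c\<^esub> x \<noteq> {}" by (simp add: coset_cspace)
    ultimately show ?thesis by (intro SUP_eq_const)
  qed
  have "(\<lambda>x. range T +>\<^bsub>cspace c\<^esub> x) \<in>
      module_hom class_ring (cspace c) (coker_space (cspace c) T)"
    unfolding module_hom_def coker_space_def quot_space_def im_eq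
    using add smult by (auto simp: A_RCOSETS_def' cspace_def)
  then show ?thesis
    using V.module_axioms coker.module_axioms
    by (simp add: mod_hom_def mod_hom_axioms_def)
qed

text \<open>The hypotheses make \<open>B\<close> a basis of a complement of the range, and the
  projection maps a complement isomorphically onto the quotient.\<close>

lemma coker_spaceI:
  assumes "finite B"
    and span: "\<And>g. \<exists>f a. g = T f + (\<Sum>b\<in>B. c (a b) * b)"
    and indep: "\<And>f a. T f = (\<Sum>b\<in>B. c (a b) * b) \<Longrightarrow> \<forall>b\<in>B. a b = 0"
  shows "vectorspace.fin_dim class_ring (coker_space (cspace c) T)"
    and "dim_coker (cspace c) T = card B"
proof -
  let ?p = "\<lambda>x. range T +>\<^bsub>cspace c\<^esub> x"
  interpret coker: vectorspace class_ring "coker_space (cspace c) T"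
    unfolding coker_space_def by (rule vectorspace_quot_space) (rule T.imT_is_subspace)
  interpret p: mod_hom class_ring "cspace c" "coker_space (cspace c) T" ?p
    by (rule coset_hom)
  have car: "carrier (coker_space (cspace c) T) = range ?p"
    unfolding coker_space_def quot_space_def im_eq A_RCOSETS_def'
    by (auto simp: cspace_def)
  have cl: "?p x \<in> carrier (coker_space (cspace c) T)" for x
    by (simp add: car)
  have z: "\<zero>\<^bsub>coker_space (cspace c) T\<^esub> = ?p 0"
    by (simp add: coker_space_def quot_space_def im_eq coset_cspace)
  have inj: "inj_on ?p B"
  proof
    fix b b' assume b: "b \<in> B" "b' \<in> B" "?p b = ?p b'"
    show "b = b'"
    proof (rule ccontr)
      assume ne: "b \<noteq> b'"
      from b obtain f where f: "T f = b - b'" unfolding coset_eq_iff by auto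
      \<comment> \<open>If two elements of \<open>B\<close> had the same coset, this nontrivial
        combination would lie in the range.\<close>
      define a where "a = (\<lambda>x. if x = b then 1 else if x = b' then -1 else (0::complex))"
      have "(\<Sum>x\<in>B. c (a x) * x) = (\<Sum>x\<in>{b, b'}. c (a x) * x)"
        using assms(1) b by (intro sum.mono_neutral_right) (auto simp: a_def)
      also have "\<dots> = b - b'" using ne by (simp add: a_def c_uminus)
      finally have "\<forall>x\<in>B. a x = 0" using indep f by simp
      with b show False by (auto simp: a_def)
    qed
  qed
  have lc: "coker.lincomb a (?p ` B) = ?p (\<Sum>b\<in>B. c (a (?p b)) * b)" for a
  proof -
    have "coker.lincomb a (?p ` B) =
        finsum (coker_space (cspace c) T) (\<lambda>b. a (?p b) \<odot>\<^bsub>coker_space (cspace c) T\<^esub> ?p b) B"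
      unfolding coker.lincomb_def
      by (rule coker.finsum_reindex[OF _ inj]) (intro funcsetI coker.smult_closed; use cl in auto)
    also have "\<dots> = finsum (coker_space (cspace c) T) (\<lambda>b. ?p (c (a (?p b)) * b)) B"
    proof (rule coker.finsum_cong')
      fix b
      show "a (?p b) \<odot>\<^bsub>coker_space (cspace c) T\<^esub> ?p b = ?p (c (a (?p b)) * b)"
        using p.f_smult[of "a (?p b)" b] by (simp add: cspace_def)
    qed (auto simp: car)
    also have "\<dots> = ?p (finsum (cspace c) (\<lambda>b. c (a (?p b)) * b) B)"
      by (rule p.hom_sum[symmetric]) (auto simp: cspace_def)
    finally show ?thesis by (simp add: finsum_cspace[OF vs assms(1)])
  qed
  have 1: "\<exists>a\<in>?p ` B \<rightarrow> carrier class_ring. X = coker.lincomb a (?p ` B)"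
    if "X \<in> carrier (coker_space (cspace c) T)" for X
  proof -
    from that obtain g where g: "X = ?p g" by (auto simp: car)
    obtain f a where fa: "g = T f + (\<Sum>b\<in>B. c (a b) * b)" using span by blast
    have "(\<Sum>b\<in>B. c (a (inv_into B ?p (?p b))) * b) = (\<Sum>b\<in>B. c (a b) * b)"
      by (intro sum.cong) (simp_all add: inv_into_f_f[OF inj])
    then have "X = coker.lincomb (\<lambda>X. a (inv_into B ?p X)) (?p ` B)"
      unfolding lc g coset_eq_iff using fa by simp
    then show "\<exists>a\<in>?p ` B \<rightarrow> carrier class_ring. X = coker.lincomb a (?p ` B)"
      by (intro bexI[of _ "\<lambda>X. a (inv_into B ?p X)"]) auto
  qed
  have 2: "\<forall>X\<in>?p ` B. a X = \<zero>\<^bsub>class_ring\<^esub>"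
    if "coker.lincomb a (?p ` B) = \<zero>\<^bsub>coker_space (cspace c) T\<^esub>" for a
  proof -
    from that have "(\<Sum>b\<in>B. c (a (?p b)) * b) - 0 \<in> range T"
      by (simp only: lc z coset_eq_iff)
    then obtain f where f: "(\<Sum>b\<in>B. c (a (?p b)) * b) - 0 = T f" by (rule rangeE)
    have "\<forall>b\<in>B. a (?p b) = 0"
      by (rule indep[of f]) (use f in simp)
    then show "\<forall>X\<in>?p ` B. a X = \<zero>\<^bsub>class_ring\<^esub>"
      by simp
  qed
  have 3: "finite (?p ` B)" "?p ` B \<subseteq> carrier (coker_space (cspace c) T)"
    using assms(1) by (auto simp: car)
  note coker.finite_basisI[OF 3 1 2]
  then show "vectorspace.fin_dim class_ring (coker_space (cspace c) T)"
    and "dim_coker (cspace c) T = card B"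
    by (auto simp: dim_coker_def card_image[OF inj])
qed

text \<open>The bases to come are families indexed by exponents, whereas the criteria above take
  sets. Along an injective family the coefficients transfer in both directions.\<close>

lemma sum_image:
  assumes "inj_on \<beta> E"
  shows   "(\<Sum>b\<in>\<beta> ` E. c (a b) * b) = (\<Sum>e\<in>E. c (a (\<beta> e)) * \<beta> e)"
  using assms by (simp add: sum.reindex)

lemma sum_image_inv:
  assumes "inj_on \<beta> E"
  shows   "(\<Sum>b\<in>\<beta> ` E. c (a (inv_into E \<beta> b)) * b) = (\<Sum>e\<in>E. c (a e) * \<beta> e)"
  unfolding sum_image[OF assms] by (intro sum.cong) (simp_all add: inv_into_f_f[OF assms])

lemma ker_space_family:
  assumes "finite E" "inj_on \<beta> E" "\<And>e. e \<in> E \<Longrightarrow> T (\<beta> e) = 0"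
    and span: "\<And>x. T x = 0 \<Longrightarrow> \<exists>a. x = (\<Sum>e\<in>E. c (a e) * \<beta> e)"
    and indep: "\<And>a. (\<Sum>e\<in>E. c (a e) * \<beta> e) = 0 \<Longrightarrow> \<forall>e\<in>E. a e = 0"
  shows "vectorspace.fin_dim class_ring (ker_space (cspace c) T)" "dim_ker (cspace c) T = card E"
proof -
  have 1: "\<exists>a. x = (\<Sum>b\<in>\<beta> ` E. c (a b) * b)" if x: "T x = 0" for x
  proof -
    obtain a where "x = (\<Sum>e\<in>E. c (a e) * \<beta> e)" using span[OF x] ..
    then have "x = (\<Sum>b\<in>\<beta> ` E. c (a (inv_into E \<beta> b)) * b)"
      unfolding sum_image_inv[OF assms(2)] .
    then show ?thesis by (rule exI[of _ "\<lambda>b. a (inv_into E \<beta> b)"])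
  qed
  have 2: "\<forall>b\<in>\<beta> ` E. a b = 0" if "(\<Sum>b\<in>\<beta> ` E. c (a b) * b) = 0" for a
    using indep[of "\<lambda>e. a (\<beta> e)"] that unfolding sum_image[OF assms(2)] by blast
  have 3: "finite (\<beta> ` E)" using assms(1) by simp
  have 4: "T b = 0" if "b \<in> \<beta> ` E" for b using that assms(3) by auto
  from ker_spaceI[OF 3 4 1 2]
  show "vectorspace.fin_dim class_ring (ker_space (cspace c) T)" "dim_ker (cspace c) T = card E"
    by (simp_all add: card_image[OF assms(2)])
qed

lemma coker_space_family:
  assumes "finite E" "inj_on \<beta> E"
    and span: "\<And>g. \<exists>f a. g = T f + (\<Sum>e\<in>E. c (a e) * \<beta> e)"
    and indep: "\<And>f a. T f = (\<Sum>e\<in>E. c (a e) * \<beta> e) \<Longrightarrow> \<forall>e\<in>E. a e = 0"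
  shows "vectorspace.fin_dim class_ring (coker_space (cspace c) T)" "dim_coker (cspace c) T = card E"
proof -
  have 1: "\<exists>f a. g = T f + (\<Sum>b\<in>\<beta> ` E. c (a b) * b)" for g
  proof -
    obtain f a where "g = T f + (\<Sum>e\<in>E. c (a e) * \<beta> e)" using span by blast
    then have "g = T f + (\<Sum>b\<in>\<beta> ` E. c (a (inv_into E \<beta> b)) * b)"
      unfolding sum_image_inv[OF assms(2)] .
    then show ?thesis by (intro exI[of _ f] exI[of _ "\<lambda>b. a (inv_into E \<beta> b)"])
  qed
  have 2: "\<forall>b\<in>\<beta> ` E. a b = 0" if "T f = (\<Sum>b\<in>\<beta> ` E. c (a b) * b)" for f a
    using indep[of f "\<lambda>e. a (\<beta> e)"] that unfolding sum_image[OF assms(2)] by blast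
  have 3: "finite (\<beta> ` E)" using assms(1) by simp
  from coker_spaceI[OF 3 1 2]
  show "vectorspace.fin_dim class_ring (coker_space (cspace c) T)" "dim_coker (cspace c) T = card E"
    by (simp_all add: card_image[OF assms(2)])
qed

end

section \<open>Convergent Laurent series\<close>

text \<open>The principal part is finite, so an exponential bound in nonnegative degrees is enough
  for convergence.\<close>

lemma fls_conv_radius_posI:
  assumes "R > 0" "eventually (\<lambda>n. norm (fls_nth F (int n)) \<le> C * R ^ n) sequentially"
  shows   "fls_conv_radius F > 0"
proof -
  \<comment> \<open>At this point the terms are bounded by C / 2^n.\<close>
  define z :: complex where "z = of_real (1 / (2 * R))"
  have "summable (\<lambda>n. fls_nth F (int n) * z ^ n)"
  proof (rule summable_comparison_test_ev)
    show "summable (\<lambda>n. C * (1 / 2 :: real) ^ n)" by simp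
    show "eventually (\<lambda>n. norm (fls_nth F (int n) * z ^ n) \<le> C * (1 / 2) ^ n) sequentially"
      using assms(2)
    proof eventually_elim
      case (elim n)
      have "norm (fls_nth F (int n) * z ^ n) \<le> (C * R ^ n) * norm z ^ n"
        unfolding norm_mult norm_power by (intro mult_right_mono elim) simp
      also have "\<dots> = C * (1 / 2) ^ n"
        using assms(1) unfolding mult.assoc power_mult_distrib[symmetric]
        by (simp add: z_def norm_divide)
      finally show ?case .
    qed
  qed
  from conv_radius_geI[OF this]
  have "fls_conv_radius F \<ge> norm z"
    by (simp add: fls_conv_radius_def fps_conv_radius_def)
  moreover have "norm z > 0" using assms(1) by (simp add: z_def)
  ultimately show ?thesis
    by (meson ereal_less(2) less_le_trans)
qed

lemma fls_conv_radius_posE: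
  assumes "fls_conv_radius F > 0"
  obtains C R where "C > 0" "R \<ge> 1" "\<And>n. norm (fls_nth F (int n)) \<le> C * R ^ n"
proof -
  obtain r where r: "0 < ereal r" "ereal r < fls_conv_radius F"
    using ereal_dense2[OF assms] by auto
  then have "r > 0" by simp
  have "summable (\<lambda>n. fls_nth F (int n) * of_real r ^ n)"
    by (rule summable_in_conv_radius)
       (use r \<open>r > 0\<close> in \<open>simp add: fls_conv_radius_def fps_conv_radius_def\<close>)
  then have "Bseq (\<lambda>n. fls_nth F (int n) * of_real r ^ n)"
    by (intro convergent_imp_Bseq convergentI[OF summable_LIMSEQ_zero])
  then obtain C where C: "C > 0" "\<And>n. norm (fls_nth F (int n) * of_real r ^ n) \<le> C"
    by (auto simp: Bseq_def)
  show ?thesis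
  \<comment> \<open>A base of at least 1 makes the bound increase with the degree, so that bounds in
    lower degrees carry over to higher ones.\<close>
  proof (rule that[of C "max 1 (1 / r)"])
    fix n
    have "norm (fls_nth F (int n)) \<le> C * (1 / r) ^ n"
      using C(2)[of n] \<open>r > 0\<close> by (simp add: norm_mult norm_power field_simps)
    also have "\<dots> \<le> C * max 1 (1 / r) ^ n"
      using C(1) \<open>r > 0\<close> by (intro mult_left_mono power_mono) auto
    finally show "norm (fls_nth F (int n)) \<le> C * max 1 (1 / r) ^ n" .
  qed (use C in auto)
qed

text \<open>Powers of \<open>fls_X\<close> are kept in \<open>powi\<close> form, the form to which
  the coefficient rules below apply.\<close>

declare fls_X_power_int [simp del]

lemma nth_const_X_powi_mult:
  "fls_nth (fls_const d * fls_X powi i * f) n = d * fls_nth (f :: 'a::field fls) (n - i)"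
proof -
  have "fls_const d * fls_X powi i * f = fls_const d * (fls_X powi i * f)"
    by (rule mult.assoc)
  also have "\<dots> = fls_const d * fls_shift (- i) f"
    by (simp only: fls_X_power_int fls_X_intpow_times_conv_shift(1))
  finally have eq: "fls_const d * fls_X powi i * f = fls_const d * fls_shift (- i) f" .
  show ?thesis unfolding eq by simp
qed

lemma nth_X_powi [simp]:
  "fls_nth (fls_X powi i :: 'a::field fls) n = (if n = i then 1 else 0)"
  by (simp add: fls_X_power_int)

lemma nth_const_X_powi:
  "fls_nth (fls_const d * fls_X powi i :: 'a::field fls) n = (if n = i then d else 0)"
  by simp

lemma nth_sum_const_X_powi:
  assumes "finite E"
  shows   "fls_nth (\<Sum>e\<in>E. fls_const (a e) * fls_X powi e :: 'a::field fls) n =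
             (if n \<in> E then a n else 0)"
  using assms by (induction E rule: finite_induct) (auto simp: nth_const_X_powi)

text \<open>Recursion upwards from the lowest degree of a Laurent series. \<open>\<Phi>\<close> is
  handed \<open>f\<close> cut off at \<open>n\<close>, so an arbitrary functional is
  admissible.\<close>

lemma int_recursion:
  "\<exists>f :: int \<Rightarrow> 'a::zero. (\<forall>n<N. f n = 0) \<and> (\<forall>n\<ge>N. f n = \<Phi> n (\<lambda>k. if k < n then f k else 0))"
proof -
  \<comment> \<open>The recursion runs over the offset from \<open>N\<close>, a natural number;
    values below \<open>N\<close> are supplied as 0.\<close>
  define H where "H = (\<lambda>f n. \<Phi> (N + int n) (\<lambda>k. if N \<le> k \<and> k < N + int n then f (nat (k - N)) else 0))"
  define F where "F = wfrec less_than H"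
  have F: "F n = H F n" for n
  proof -
    have "F n = H (cut F less_than n) n"
      unfolding F_def by (rule wfrec) simp
    also have "\<dots> = H F n"
      unfolding H_def by (intro arg_cong2[of _ _ _ _ \<Phi>] refl ext) (auto simp: cut_def)
    finally show ?thesis .
  qed
  define f where "f = (\<lambda>n. if n < N then 0 else F (nat (n - N)))"
  have "f n = \<Phi> n (\<lambda>k. if k < n then f k else 0)" if "n \<ge> N" for n
  proof -
    have "f n = H F (nat (n - N))" using that F by (simp add: f_def)
    also have "\<dots> = \<Phi> n (\<lambda>k. if k < n then f k else 0)"
      unfolding H_def using that by (intro arg_cong2[of _ _ _ _ \<Phi>] ext) (auto simp: f_def)
    finally show ?thesis .
  qed
  moreover have "\<forall>n<N. f n = 0" by (simp add: f_def)
  ultimately show ?thesis by blast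
qed

lemma fls_nth_Abs_fls_below:
  assumes "\<forall>n<N. f n = 0"
  shows   "fls_nth (Abs_fls f) n = f n"
  using nth_Abs_fls_lower_bound[OF assms] .

section \<open>The operator with monomial coefficient on Laurent series\<close>

definition qop :: "complex \<Rightarrow> complex \<Rightarrow> int \<Rightarrow> complex fls \<Rightarrow> complex fls" where
  "qop q d \<nu> h = formal_sigma q h - fls_const d * fls_X powi \<nu> * h"

lemma nth_qop:
  "q \<noteq> 0 \<Longrightarrow> fls_nth (qop q d \<nu> h) n = q powi n * fls_nth h n - d * fls_nth h (n - \<nu>)"
  by (simp add: qop_def fls_nth_formal_sigma nth_const_X_powi_mult)

text \<open>Exponents rather than dimensions are recorded, because the gauge factor turns these
  monomials into explicit bases in each field. Monomials are linearly independent, so the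
  cardinalities of \<open>E\<close> and \<open>E'\<close> become the dimensions.\<close>

definition qop_bases ::
    "complex fls set \<Rightarrow> complex \<Rightarrow> complex \<Rightarrow> int \<Rightarrow> int set \<Rightarrow> int set \<Rightarrow> bool" where
  "qop_bases D q d \<nu> E E' \<longleftrightarrow> finite E \<and> finite E' \<and>
     (\<forall>e\<in>E. qop q d \<nu> (fls_X powi e) = 0) \<and>
     (\<forall>h\<in>D. qop q d \<nu> h = 0 \<longrightarrow> (\<exists>a. h = (\<Sum>e\<in>E. fls_const (a e) * fls_X powi e))) \<and>
     (\<forall>g\<in>D. \<exists>h\<in>D. \<exists>a. g = qop q d \<nu> h + (\<Sum>e\<in>E'. fls_const (a e) * fls_X powi e)) \<and>
     (\<forall>h\<in>D. \<forall>a. qop q d \<nu> h = (\<Sum>e\<in>E'. fls_const (a e) * fls_X powi e) \<longrightarrow> (\<forall>e\<in>E'. a e = 0))"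

definition conv_fls :: "complex fls set" where
  "conv_fls = {F. fls_conv_radius F > 0}"

lemma eventually_norm_power_ge:
  assumes "norm (q :: complex) > 1"
  shows   "eventually (\<lambda>n. norm (q ^ n) \<ge> c) sequentially"
proof -
  have "filterlim (\<lambda>n. norm q ^ n) at_top sequentially"
    using filterlim_realpow_sequentially_gt1[OF assms]
    by (simp add: filterlim_at_infinity_conv_norm_at_top norm_power)
  then show ?thesis by (simp add: filterlim_at_top norm_power)
qed

section \<open>The case \<nu> = 0: a diagonal operator\<close>

text \<open>The coefficient of degree n is multiplied by q^n - d. From some degree on this factor
  has norm at least 1, so dividing by it keeps an exponential bound.\<close>

lemma qop_0_solution:
  assumes q: "norm q > 1"
  obtains h where "\<And>n. q powi n \<noteq> d \<Longrightarrow> fls_nth (qop q d 0 h) n = fls_nth g n"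
    and "g \<in> conv_fls \<Longrightarrow> h \<in> conv_fls"
proof -
  have q0: "q \<noteq> 0" using q by auto
  obtain N where N: "\<forall>n<N. fls_nth g n = 0" by (elim fls_nth_vanishes_belowE)
  \<comment> \<open>In a resonant degree division by 0 gives the coefficient 0; the claim excludes
    that degree.\<close>
  define h where "h = Abs_fls (\<lambda>n. fls_nth g n / (q powi n - d))"
  have h: "fls_nth h n = fls_nth g n / (q powi n - d)" for n
    unfolding h_def by (rule fls_nth_Abs_fls_below[of N]) (use N in auto)
  show ?thesis
  proof (rule that[of h])
    show "fls_nth (qop q d 0 h) n = fls_nth g n" if "q powi n \<noteq> d" for n
    proof -
      have "fls_nth (qop q d 0 h) n = (q powi n - d) * fls_nth h n"
        using q0 by (simp add: nth_qop algebra_simps)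
      then show ?thesis using that by (simp add: h)
    qed
  next
    assume "g \<in> conv_fls"
    then obtain C R where CR: "C > 0" "R \<ge> 1" "\<And>n. norm (fls_nth g (int n)) \<le> C * R ^ n"
      unfolding conv_fls_def by (auto elim: fls_conv_radius_posE)
    have "eventually (\<lambda>n. norm (fls_nth h (int n)) \<le> C * R ^ n) sequentially"
      using eventually_norm_power_ge[OF q, of "1 + norm d"]
    proof eventually_elim
      case (elim n)
      have "norm (q ^ n - d) \<ge> 1" using elim norm_triangle_ineq2[of "q ^ n" d] by linarith
      then have "norm (fls_nth h (int n)) \<le> norm (fls_nth g (int n)) / 1"
        unfolding h norm_divide by (intro divide_left_mono) auto
      with CR(3)[of n] show ?case by simp
    qed
    then show "h \<in> conv_fls"
      unfolding conv_fls_def using CR(2) by (auto intro: fls_conv_radius_posI[of R])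
  qed
qed

lemma qop_bases_0_nonresonant:
  assumes "norm q > 1" "\<not> (\<exists>k::int. d = q powi k)" "D = UNIV \<or> D = conv_fls"
  shows   "qop_bases D q d 0 {} {}"
proof -
  have q0: "q \<noteq> 0" using assms(1) by auto
  have "h = 0" if "qop q d 0 h = 0" for h
  proof (rule fls_eqI)
    fix n
    have "(q powi n - d) * fls_nth h n = fls_nth (qop q d 0 h) n"
      using q0 by (simp add: nth_qop algebra_simps)
    then show "fls_nth h n = fls_nth 0 n" using that assms(2) by auto
  qed
  moreover have "\<exists>h\<in>D. g = qop q d 0 h" if "g \<in> D" for g
  proof -
    obtain h where h: "\<And>n. q powi n \<noteq> d \<Longrightarrow> fls_nth (qop q d 0 h) n = fls_nth g n"
      "g \<in> conv_fls \<Longrightarrow> h \<in> conv_fls"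
      by (rule qop_0_solution[OF assms(1)]) (rule that)
    then have "g = qop q d 0 h" using assms(2) by (intro fls_eqI) metis
    with h(2) that assms(3) show ?thesis by auto
  qed
  ultimately show ?thesis by (auto simp: qop_bases_def)
qed

lemma powi_inj:
  assumes "norm (q :: complex) > 1" "q powi m = q powi n"
  shows   "m = n"
proof -
  have "norm q powi m = norm q powi n"
    using assms(2) by (metis norm_power_int)
  then show ?thesis using assms(1)
    by (smt (verit) power_int_strict_increasing)
qed

text \<open>The factor q^n - q^k vanishes in degree k and nowhere else. That degree is free in the
  kernel and unreachable in the image, which gives one dimension to each.\<close>

lemma qop_bases_0_resonant:
  assumes q: "norm q > 1" and d: "d = q powi k" and D: "D = UNIV \<or> D = conv_fls"
  shows   "qop_bases D q d 0 {k} {k}"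
proof -
  have q0: "q \<noteq> 0" using assms(1) by auto
  have L: "fls_nth (qop q d 0 h) n = (q powi n - q powi k) * fls_nth h n" for h n
    using q0 by (simp add: nth_qop d algebra_simps)
  have nz: "q powi n - q powi k \<noteq> 0" if "n \<noteq> k" for n
    using powi_inj[OF q] that by auto
  have X: "fls_nth (fls_X powi k :: complex fls) n = (if n = k then 1 else 0)" for n
    using nth_const_X_powi[of 1 k n] by simp
  have "qop q d 0 (fls_X powi k) = 0"
    by (intro fls_eqI) (simp add: L X)
  moreover have "\<exists>a. h = fls_const (a k) * fls_X powi k" if "qop q d 0 h = 0" for h
  proof (intro exI[of _ "fls_nth h"] fls_eqI)
    fix n
    show "fls_nth h n = fls_nth (fls_const (fls_nth h k) * fls_X powi k) n"
      using L[of h n] nz[of n] that by (auto simp: nth_const_X_powi)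
  qed
  moreover have "\<exists>h\<in>D. \<exists>a. g = qop q d 0 h + fls_const (a k) * fls_X powi k" if "g \<in> D" for g
  proof -
    obtain h where h: "\<And>n. q powi n \<noteq> d \<Longrightarrow> fls_nth (qop q d 0 h) n = fls_nth g n"
      "g \<in> conv_fls \<Longrightarrow> h \<in> conv_fls"
      by (rule qop_0_solution[OF assms(1)]) (rule that)
    have "g = qop q d 0 h + fls_const (fls_nth g k) * fls_X powi k"
    proof (rule fls_eqI)
      fix n
      show "fls_nth g n = fls_nth (qop q d 0 h + fls_const (fls_nth g k) * fls_X powi k) n"
        using h(1)[of n] L[of h k] nz[of n] by (auto simp: nth_const_X_powi d)
    qed
    moreover have "h \<in> D" using h(2) that D by auto
    ultimately show ?thesis by (intro bexI[of _ h] exI[of _ "fls_nth g"])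
  qed
  moreover have "a = 0" if "qop q d 0 h = fls_const a * fls_X powi k" for h a
    using L[of h k] that by (simp add: nth_const_X_powi)
  ultimately show ?thesis unfolding qop_bases_def by simp
qed

section \<open>Trivial kernel for \<nu> \<noteq> 0, and the case \<nu> > 0\<close>

text \<open>For \<open>h\<close> of lowest degree s the two terms of the operator have lowest
  degrees s and s + \<nu>. These differ, so the lower one cannot cancel. Convergence does not enter,
  hence the formal and convergent cases share the argument.\<close>

lemma qop_kernel_trivial:
  assumes "q \<noteq> 0" "d \<noteq> 0" "\<nu> \<noteq> 0" "qop q d \<nu> h = 0"
  shows   "h = 0"
proof (rule ccontr)
  assume h: "h \<noteq> 0"
  define s where "s = fls_subdegree h"
  have s: "fls_nth h s \<noteq> 0" "\<And>n. n < s \<Longrightarrow> fls_nth h n = 0"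
    using h by (auto simp: s_def)
  have "q powi n * fls_nth h n = d * fls_nth h (n - \<nu>)" for n
    using nth_qop[OF assms(1), of d \<nu> h n] assms(4) by simp
  from this[of s] this[of "s + \<nu>"] show False
    using s assms(1-3) by (cases "\<nu> > 0") auto
qed

text \<open>Here h_n = (g_n + d h_(n - \<nu>)) / q^n refers to a lower degree, and the division by
  q^n eventually shrinks the numerator enough to keep a bound B * R^n.\<close>

lemma qop_pos_solution:
  assumes q: "norm q > 1" and \<nu>: "\<nu> > 0"
  obtains h where "qop q d \<nu> h = g" and "g \<in> conv_fls \<Longrightarrow> h \<in> conv_fls"
proof -
  have q0: "q \<noteq> 0" using q by auto
  obtain N where N: "\<forall>n<N. fls_nth g n = 0" by (elim fls_nth_vanishes_belowE)
  obtain f where f: "\<forall>n<N. f n = 0"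
    "\<forall>n\<ge>N. f n = (fls_nth g n + d * (if n - \<nu> < n then f (n - \<nu>) else 0)) / q powi n"
    using int_recursion[of N "\<lambda>n f. (fls_nth g n + d * f (n - \<nu>)) / q powi n"] by blast
  define h where "h = Abs_fls f"
  have h: "fls_nth h n = f n" for n
    unfolding h_def by (rule fls_nth_Abs_fls_below) (rule f)
  have f': "f n = (fls_nth g n + d * f (n - \<nu>)) / q powi n" for n
    using f N \<nu> by (cases "n \<ge> N") auto
  show ?thesis
  proof (rule that[of h])
    show "qop q d \<nu> h = g"
    proof (rule fls_eqI)
      fix n
      show "fls_nth (qop q d \<nu> h) n = fls_nth g n"
        using q0 f'[of n] by (simp add: nth_qop h field_simps)
    qed
  next
    assume "g \<in> conv_fls"
    then obtain C R where CR: "C > 0" "R \<ge> 1" "\<And>n. norm (fls_nth g (int n)) \<le> C * R ^ n"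
      unfolding conv_fls_def by (auto elim: fls_conv_radius_posE)
    \<comment> \<open>The numerator is at most (1 + |d|) * B * R^n: one share for g_n and |d| shares
      for the earlier coefficient.\<close>
    obtain M where M: "\<And>n. n \<ge> M \<Longrightarrow> norm (q ^ n) \<ge> 1 + norm d"
      using eventually_norm_power_ge[OF q, of "1 + norm d"]
      by (auto simp: eventually_at_top_linorder)
    \<comment> \<open>From \<open>nat \<nu>\<close> on, the earlier degree \<open>n - \<nu>\<close>
      is nonnegative and covered by the induction hypothesis.\<close>
    define M' where "M' = max M (nat \<nu>)"
    define B where "B = Max (insert C ((\<lambda>n. norm (f (int n))) ` {..<M'}))"
    have B: "B \<ge> C" "\<And>n. n < M' \<Longrightarrow> norm (f (int n)) \<le> B"
      by (auto simp: B_def)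
    have "norm (f (int n)) \<le> B * R ^ n" for n
    proof (induction n rule: less_induct)
      case (less n)
      have B0: "B > 0" and R0: "R ^ n \<ge> 1" using CR B by auto
      show ?case
      proof (cases "n < M'")
        case True
        have "norm (f (int n)) \<le> B * 1" using B True by auto
        also have "\<dots> \<le> B * R ^ n" using B0 R0 by (intro mult_left_mono) auto
        finally show ?thesis .
      next
        case False
        then have n: "n \<ge> M" "nat \<nu> \<le> n" by (auto simp: M'_def)
        have 1: "norm (f (int n - \<nu>)) \<le> B * R ^ n"
        proof -
          have "norm (f (int (n - nat \<nu>))) \<le> B * R ^ (n - nat \<nu>)"
            using n \<nu> by (intro less) auto
          also have "\<dots> \<le> B * R ^ n" using B0 CR by (intro mult_left_mono power_increasing) auto
          also have "int (n - nat \<nu>) = int n - \<nu>" using n \<nu> by simp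
          finally show ?thesis .
        qed
        have 2: "norm (fls_nth g (int n)) \<le> B * R ^ n"
          using CR(3)[of n] B(1) R0 mult_right_mono[of C B "R ^ n"] by linarith
        have "norm (fls_nth g (int n) + d * f (int n - \<nu>)) \<le> B * R ^ n + norm d * (B * R ^ n)"
          using 1 2 by (intro order.trans[OF norm_triangle_ineq] add_mono) (auto simp: norm_mult intro: mult_left_mono)
        also have "\<dots> = (1 + norm d) * (B * R ^ n)" by (simp add: algebra_simps)
        also have "\<dots> \<le> norm (q ^ n) * (B * R ^ n)"
          using M[OF n(1)] B0 R0 by (intro mult_right_mono) auto
        finally show ?thesis
          using q0 by (subst f') (simp add: norm_divide field_simps)
      qed
    qed
    then show "h \<in> conv_fls"
      unfolding conv_fls_def mem_Collect_eq
      by (intro fls_conv_radius_posI[of R _ B]) (use CR(2) in \<open>auto simp: h\<close>)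
  qed
qed

lemma qop_bases_pos:
  assumes "norm q > 1" "d \<noteq> 0" "\<nu> > 0" "D = UNIV \<or> D = conv_fls"
  shows   "qop_bases D q d \<nu> {} {}"
proof -
  have "\<exists>h\<in>D. g = qop q d \<nu> h" if "g \<in> D" for g
  proof -
    obtain h where "qop q d \<nu> h = g" "g \<in> conv_fls \<Longrightarrow> h \<in> conv_fls"
      by (rule qop_pos_solution[OF assms(1,3)]) (rule that)
    then show ?thesis using \<open>g \<in> D\<close> assms(4) by (intro bexI[of _ h]) auto
  qed
  moreover have "h = 0" if "qop q d \<nu> h = 0" for h
    by (rule qop_kernel_trivial[of q d \<nu>]) (use assms that in auto)
  ultimately show ?thesis unfolding qop_bases_def by auto
qed

section \<open>The case \<nu> < 0, with m = -\<nu>\<close>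

text \<open>The equation q^n h_n - d h_(n + m) = g_n is solved for the higher coefficient. This
  divides only by the constant d and multiplies by powers of q, so it is a purely formal
  solution.\<close>

lemma qop_neg_solution:
  assumes "q \<noteq> 0" "d \<noteq> 0" "m > 0"
  obtains h where "qop q d (- m) h = g"
proof -
  obtain N where N: "\<forall>n<N. fls_nth g n = 0" by (elim fls_nth_vanishes_belowE)
  \<comment> \<open>The start is \<open>N + m\<close>, not \<open>N\<close>: the equation in degree
    n determines the coefficient of degree n + m, and below degree N it reads 0 = 0.\<close>
  obtain f where f: "\<forall>n<N + m. f n = 0"
    "\<forall>n\<ge>N + m. f n = (q powi (n - m) * (if n - m < n then f (n - m) else 0) - fls_nth g (n - m)) / d"
    using int_recursion[of "N + m" "\<lambda>n f. (q powi (n - m) * f (n - m) - fls_nth g (n - m)) / d"]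
    by blast
  define h where "h = Abs_fls f"
  have h: "fls_nth h n = f n" for n
    unfolding h_def by (rule fls_nth_Abs_fls_below) (rule f)
  have f': "f n = (q powi (n - m) * f (n - m) - fls_nth g (n - m)) / d" for n
    using f N assms(3) by (cases "n \<ge> N + m") auto
  have "qop q d (- m) h = g"
  proof (rule fls_eqI)
    fix n
    show "fls_nth (qop q d (- m) h) n = fls_nth g n"
      using assms f'[of "n + m"] by (simp add: nth_qop h field_simps)
  qed
  then show ?thesis by (rule that)
qed

lemma qop_bases_neg_formal:
  assumes "norm q > 1" "d \<noteq> 0" "\<nu> < 0"
  shows   "qop_bases UNIV q d \<nu> {} {}"
proof -
  have q0: "q \<noteq> 0" using assms(1) by auto
  have "\<exists>h. g = qop q d \<nu> h" for g
    by (rule qop_neg_solution[of q d "- \<nu>" g]) (use q0 assms in auto)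
  moreover have "h = 0" if "qop q d \<nu> h = 0" for h
    by (rule qop_kernel_trivial[of q d \<nu>]) (use assms that in auto)
  ultimately show ?thesis unfolding qop_bases_def by auto
qed

text \<open>The terms are K^j / Q^(j(j-1)/2), with ratio \<open>K / Q ^ j\<close> tending to 0. This
  decay absorbs any geometric growth, however large \<open>K\<close> is.\<close>

lemma summable_prod_geometric:
  fixes K Q :: real
  assumes "Q > 1" "K \<ge> 0"
  shows   "summable (\<lambda>j. \<Prod>i<j. K / Q ^ i)"
proof -
  have "(\<lambda>j. K / Q ^ j) \<longlonglongrightarrow> 0"
    using assms(1) by (intro tendsto_divide_0[OF tendsto_const] filterlim_realpow_sequentially_gt1) auto
  then have "eventually (\<lambda>j. K / Q ^ j < 1 / 2) sequentially"
    by (rule order_tendstoD) simp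
  then obtain N where N: "\<And>j. j \<ge> N \<Longrightarrow> K / Q ^ j < 1 / 2"
    by (auto simp: eventually_at_top_linorder)
  show ?thesis
  proof (rule summable_ratio_test[of "1/2" N])
    fix j assume "j \<ge> N"
    then have "(\<Prod>i<j. K / Q ^ i) * (K / Q ^ j) \<le> (\<Prod>i<j. K / Q ^ i) * (1 / 2)"
      using assms N[of j] by (intro mult_left_mono prod_nonneg) auto
    moreover have "(\<Prod>i<j. K / Q ^ i) \<ge> 0" for j
      using assms by (intro prod_nonneg) auto
    ultimately show "norm (\<Prod>i<Suc j. K / Q ^ i) \<le> 1 / 2 * norm (\<Prod>i<j. K / Q ^ i)"
      using assms by (simp add: abs_mult)
  qed simp
qed

text \<open>Iterating h_n = q^(-n) (g_n + d h_(n + m)) produces g_(n + jm) with this weight, which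
  equals d^j times the product of q^(-(n + im)) over 0 \<le> i \<le> j.\<close>

primrec qweight :: "complex \<Rightarrow> complex \<Rightarrow> int \<Rightarrow> int \<Rightarrow> nat \<Rightarrow> complex" where
  "qweight q d m n 0 = q powi (- n)"
| "qweight q d m n (Suc j) = q powi (- n) * d * qweight q d m (n + m) j"

text \<open>As m \<ge> 1, the exponent n + im is at least s + i; the last power, which comes without
  a factor d, is bounded by 1. The induction varies \<open>s\<close> because the tail starts at n +
  m \<ge> s + 1.\<close>

lemma norm_qweight_le:
  assumes "norm q > 1" "m > 0" "n \<ge> int s"
  shows   "norm (qweight q d m n j) \<le> (\<Prod>i<j. norm d / norm q ^ (s + i))"
  using assms(3)
proof (induction j arbitrary: n s)
  case 0
  have "norm q powi (- n) \<le> norm q powi 0"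
    using 0 assms(1) by (intro power_int_increasing) auto
  then show ?case by (simp add: norm_power_int)
next
  case (Suc j)
  have "norm q powi (- n) \<le> norm q powi (- int s)"
    using Suc.prems assms(1) by (intro power_int_increasing) auto
  then have 1: "norm (q powi (- n) * d) \<le> norm d / norm q ^ s"
    by (simp add: norm_mult norm_power_int norm_inverse power_int_minus divide_inverse mult.commute mult_left_mono)
  have "norm (qweight q d m (n + m) j) \<le> (\<Prod>i<j. norm d / norm q ^ (Suc s + i))"
    using Suc.prems assms(2) by (intro Suc.IH) auto
  then have "norm (qweight q d m n (Suc j)) \<le>
      (norm d / norm q ^ s) * (\<Prod>i<j. norm d / norm q ^ (Suc s + i))"
    unfolding qweight.simps norm_mult[of "_ * d"] by (intro mult_mono 1) auto
  also have "\<dots> = (\<Prod>i<Suc j. norm d / norm q ^ (s + i))"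
    by (subst prod.lessThan_Suc_shift) simp
  finally show ?case .
qed

text \<open>Solving for the lower coefficient and iterating gives a series over the g_(n + jm), a
  solution started at infinity. The quadratic exponent in the weights beats the geometric growth of
  \<open>g\<close>, and the sum inherits the bound C' * R^n.\<close>

lemma qop_neg_top_solution:
  assumes q: "norm q > 1" and m: "m > 0" and g: "g \<in> conv_fls"
  obtains S C R where "R \<ge> 1" "\<And>n. norm (S (int n)) \<le> C * R ^ n"
    and "\<And>n. n \<ge> 0 \<Longrightarrow> q powi n * S n - d * S (n + m) = fls_nth g n"
proof -
  have q0: "q \<noteq> 0" using q by auto
  obtain C R where CR: "C > 0" "R \<ge> 1" "\<And>n. norm (fls_nth g (int n)) \<le> C * R ^ n"
    using g unfolding conv_fls_def by (auto elim: fls_conv_radius_posE)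
  define t where "t = (\<lambda>n j. qweight q d m n j * fls_nth g (n + int j * m))"
  \<comment> \<open>The factor \<open>R ^ nat m\<close> is the growth of the bound on
    \<open>g\<close> per step of length m; it is moved into the product so that one summable
    majorant serves all \<open>n\<close>.\<close>
  define b where "b = (\<lambda>j. \<Prod>i<j. norm d * R ^ nat m / norm q ^ i)"
  have b: "summable b"
    unfolding b_def by (rule summable_prod_geometric) (use q CR in auto)
  have t: "norm (t (int n) j) \<le> C * R ^ n * b j" for n j
  proof -
    have "norm (qweight q d m (int n) j) \<le> (\<Prod>i<j. norm d / norm q ^ i)"
      using norm_qweight_le[OF q m, of 0 "int n"] by simp
    moreover have "norm (fls_nth g (int n + int j * m)) \<le> C * R ^ n * (R ^ nat m) ^ j"
    proof -
      have "int n + int j * m = int (n + j * nat m)" using m by simp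
      then have "norm (fls_nth g (int n + int j * m)) \<le> C * R ^ (n + j * nat m)"
        using CR(3) by metis
      then show ?thesis by (simp add: power_add power_mult mult_ac flip: power_mult)
    qed
    ultimately have "norm (t (int n) j) \<le>
        (\<Prod>i<j. norm d / norm q ^ i) * (C * R ^ n * (R ^ nat m) ^ j)"
      unfolding t_def norm_mult by (intro mult_mono) (auto intro!: prod_nonneg)
    also have "\<dots> = C * R ^ n * ((\<Prod>i<j. norm d / norm q ^ i) * (\<Prod>i<j. R ^ nat m))"
      by (simp add: mult_ac)
    also have "\<dots> = C * R ^ n * b j"
      unfolding b_def by (subst prod.distrib[symmetric]) (simp add: mult_ac)
    finally show ?thesis .
  qed
  have sm: "summable (t (int n))" for n
    by (rule summable_comparison_test'[OF summable_mult[OF b, of "C * R ^ n"], of 0]) (use t in auto)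
  define S where "S = (\<lambda>n. suminf (t n))"
  show ?thesis
  proof (rule that[of R S "C * suminf b"])
    fix n :: nat
    have "norm (S (int n)) \<le> (\<Sum>j. C * R ^ n * b j)"
      unfolding S_def by (rule norm_suminf_le) (use t b in \<open>auto intro: summable_mult\<close>)
    also have "\<dots> = C * suminf b * R ^ n" using b by (simp add: suminf_mult)
    finally show "norm (S (int n)) \<le> C * suminf b * R ^ n" .
  next
    fix n :: int assume n: "n \<ge> 0"
    have sm1: "summable (t n)" and sm2: "summable (t (n + m))"
      using sm[of "nat n"] sm[of "nat (n + m)"] n m by auto
    \<comment> \<open>Splitting off the term j = 0 leaves q^(-n) d times the series at n + m, which
      is the recurrence.\<close>
    have "suminf (t n) = (\<Sum>j. t n (Suc j)) + t n 0"
      using suminf_split_head[OF sm1] by simp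
    also have "(\<lambda>j. t n (Suc j)) = (\<lambda>j. q powi (- n) * d * t (n + m) j)"
      by (simp add: t_def fun_eq_iff algebra_simps)
    also have "suminf \<dots> = q powi (- n) * d * suminf (t (n + m))"
      by (rule suminf_mult[OF sm2])
    also have "t n 0 = q powi (- n) * fls_nth g n" by (simp add: t_def)
    finally show "q powi n * S n - d * S (n + m) = fls_nth g n"
      using q0 by (simp add: S_def power_int_minus field_simps)
  qed (use CR in auto)
qed

text \<open>Along n, n + m, n + 2m, ... each step multiplies the coefficient by a power of q over d
  with ever larger exponent. One nonzero coefficient therefore forces growth beyond every
  exponential bound.\<close>

lemma conv_fls_recurrence_zero:
  assumes q: "norm q > 1" and d: "d \<noteq> 0" and m: "m > 0" and h: "h \<in> conv_fls"
    and rec: "\<And>n. n \<ge> m \<Longrightarrow> q powi n * fls_nth h n = d * fls_nth h (n + m)"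
    and n: "n \<ge> m"
  shows "fls_nth h n = 0"
proof (rule ccontr)
  assume nz: "fls_nth h n \<noteq> 0"
  have q0: "q \<noteq> 0" using q by auto
  obtain C R where CR: "C > 0" "R \<ge> 1" "\<And>n. norm (fls_nth h (int n)) \<le> C * R ^ n"
    using h unfolding conv_fls_def by (auto elim: fls_conv_radius_posE)
  \<comment> \<open>Once the power of q exceeds \<open>K\<close> in norm, a step of length m gains
    at least 2 * R^m: the part R^m matches the permitted growth and the 2 exceeds it.\<close>
  define K where "K = 2 * norm d * R ^ nat m"
  define y where "y = (\<lambda>j::nat. norm (fls_nth h (n + int j * m)))"
  obtain J where J: "\<And>j. j \<ge> J \<Longrightarrow> norm (q ^ j) \<ge> K"
    using eventually_norm_power_ge[OF q, of K] by (auto simp: eventually_at_top_linorder)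
  have y_Suc: "norm q powi (n + int j * m) * y j = norm d * y (Suc j)" for j
  proof -
    have "n + int j * m \<ge> m" using n m by (simp add: add_increasing2)
    from rec[OF this] show ?thesis
      by (simp add: y_def algebra_simps flip: norm_mult norm_power_int)
  qed
  have y0: "y j > 0" for j
  proof (induction j)
    case (Suc j)
    have "norm q powi (n + int j * m) * y j > 0"
      using Suc q by (intro mult_pos_pos zero_less_power_int) auto
    with y_Suc[of j] d show ?case by (simp add: zero_less_mult_iff)
  qed (use nz in \<open>simp add: y_def\<close>)
  have growth: "y (Suc j) \<ge> 2 * R ^ nat m * y j" if "j \<ge> J" for j
  proof -
    have "int j \<le> n + int j * m"
      using n m mult_left_mono[of 1 m "int j"] by simp
    then have "norm q powi int j \<le> norm q powi (n + int j * m)"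
      using q by (intro power_int_increasing) auto
    with J[OF that] have "K \<le> norm q powi (n + int j * m)"
      by (simp add: norm_power)
    then have "K * y j \<le> norm d * y (Suc j)"
      unfolding y_Suc[symmetric] using y0[of j] by (intro mult_right_mono) auto
    then have "norm d * (2 * R ^ nat m * y j) \<le> norm d * y (Suc j)"
      by (simp add: K_def mult_ac)
    then show ?thesis using d by (subst (asm) mult_le_cancel_left_pos) auto
  qed
  have lower: "y (J + i) \<ge> 2 ^ i * R ^ (nat m * i) * y J" for i
  proof (induction i)
    case (Suc i)
    have "2 ^ Suc i * R ^ (nat m * Suc i) * y J = 2 * R ^ nat m * (2 ^ i * R ^ (nat m * i) * y J)"
      by (simp add: power_add mult_ac)
    also have "\<dots> \<le> 2 * R ^ nat m * y (J + i)"
      using CR by (intro mult_left_mono Suc) auto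
    also have "\<dots> \<le> y (J + Suc i)" using growth[of "J + i"] by simp
    finally show ?case .
  qed simp
  define B where "B = C * R ^ nat (n + int J * m)"
  \<comment> \<open>The common factor R^(m i) of the lower and upper bounds cancels, leaving powers
    of 2 below a constant.\<close>
  have upper: "2 ^ i * y J \<le> B" for i
  proof -
    have e: "n + int (J + i) * m = int (nat (n + int J * m) + nat m * i)"
      using n m by (simp add: algebra_simps)
    have "2 ^ i * R ^ (nat m * i) * y J \<le> y (J + i)" by (rule lower)
    also have "\<dots> \<le> C * R ^ (nat (n + int J * m) + nat m * i)"
      unfolding y_def e by (rule CR)
    also have "\<dots> = B * R ^ (nat m * i)" by (simp add: B_def power_add)
    finally have "(2 ^ i * y J) * R ^ (nat m * i) \<le> B * R ^ (nat m * i)" by (simp add: mult_ac)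
    then show ?thesis
      using CR(2) by (subst (asm) mult_le_cancel_right_pos) auto
  qed
  obtain i where "B / y J < 2 ^ i" using real_arch_pow[of 2 "B / y J"] by auto
  with y0[of J] have "B < 2 ^ i * y J" by (simp add: field_simps)
  with upper[of i] show False by simp
qed

text \<open>Below degree \<open>m\<close> the formal recursion is started from the bottom; from degree \<open>m\<close> on it is
  solved from infinity, which is the only way to get convergence. The two halves clash exactly in
  degrees \<open>0, \<dots>, m - 1\<close>.\<close>

lemma qop_bases_neg_conv:
  assumes q: "norm q > 1" and d: "d \<noteq> 0" and m: "m > 0"
  shows   "qop_bases conv_fls q d (- m) {} {0..<m}"
proof -
  have q0: "q \<noteq> 0" using q by auto
  have span: "\<exists>h\<in>conv_fls. \<exists>a. g = qop q d (- m) h + (\<Sum>e\<in>{0..<m}. fls_const (a e) * fls_X powi e)"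
    if g: "g \<in> conv_fls" for g
  proof -
    obtain H where H: "qop q d (- m) H = g"
      by (rule qop_neg_solution[OF q0 d m])
    obtain S C R where S: "R \<ge> 1" "\<And>n. norm (S (int n)) \<le> C * R ^ n"
      "\<And>n. n \<ge> 0 \<Longrightarrow> q powi n * S n - d * S (n + m) = fls_nth g n"
      by (rule qop_neg_top_solution[OF q m g, of d]) (rule that)
    obtain N where N: "\<forall>n<N. fls_nth H n = 0" by (elim fls_nth_vanishes_belowE)
    define h where "h = Abs_fls (\<lambda>n. if n < m then fls_nth H n else S n)"
    have h: "fls_nth h n = (if n < m then fls_nth H n else S n)" for n
      unfolding h_def by (rule fls_nth_Abs_fls_below[of "min N m"]) (use N in auto)
    define a where "a = (\<lambda>n. fls_nth g n - fls_nth (qop q d (- m) h) n)"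
    \<comment> \<open>The equation in degree n involves degrees n and n + m. Both are taken from
      \<open>H\<close> if n < 0 and both from \<open>S\<close> if n \<ge> m, so the defect
      \<open>a\<close> lives in between.\<close>
    have "fls_nth (qop q d (- m) h) n = fls_nth g n" if "n \<notin> {0..<m}" for n
      using that S(3)[of n] m H q0 nth_qop[OF q0, of d "- m" H n]
      by (auto simp: nth_qop h)
    then have "g = qop q d (- m) h + (\<Sum>e\<in>{0..<m}. fls_const (a e) * fls_X powi e)"
      by (intro fls_eqI) (simp add: nth_sum_const_X_powi a_def)
    moreover have "h \<in> conv_fls"
    proof -
      have "eventually (\<lambda>n. norm (fls_nth h (int n)) \<le> C * R ^ n) sequentially"
        using eventually_ge_at_top[of "nat m"]
        by eventually_elim (use S(2) in \<open>auto simp: h\<close>)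
      with S(1) show ?thesis
        unfolding conv_fls_def by (auto intro: fls_conv_radius_posI[of R])
    qed
    ultimately show ?thesis by blast
  qed
  have indep: "\<forall>e\<in>{0..<m}. a e = 0"
    if hc: "h \<in> conv_fls" and eq: "qop q d (- m) h = (\<Sum>e\<in>{0..<m}. fls_const (a e) * fls_X powi e)"
    for h a
  proof -
    have L: "q powi n * fls_nth h n - d * fls_nth h (n + m) = (if n \<in> {0..<m} then a n else 0)" for n
      using nth_qop[OF q0, of d "- m" h n] unfolding eq
      by (simp add: nth_sum_const_X_powi)
    have low: "fls_nth h n = 0" if "n < m" for n
    proof (rule ccontr)
      assume nz: "fls_nth h n \<noteq> 0"
      then have "h \<noteq> 0" by auto
      moreover have "fls_subdegree h \<le> n" using nz by (rule fls_subdegree_leI)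
      \<comment> \<open>In degree s - m, with s < m the lowest degree of \<open>h\<close>, the
        right-hand side is 0 and only -d h_s survives on the left.\<close>
      ultimately show False
        using L[of "fls_subdegree h - m"] that d m by auto
    qed
    have high: "fls_nth h n = 0" if "n \<ge> m" for n
    proof (rule conv_fls_recurrence_zero[OF q d m hc _ that])
      show "q powi n * fls_nth h n = d * fls_nth h (n + m)" if "n \<ge> m" for n
        using L[of n] that by simp
    qed
    show ?thesis
    proof
      fix e assume "e \<in> {0..<m}"
      with L[of e] low[of e] high[of "e + m"] show "a e = 0" by auto
    qed
  qed
  have ker: "h = 0" if "qop q d (- m) h = 0" for h
    by (rule qop_kernel_trivial[of q d "- m"]) (use assms that in auto)
  show ?thesis
    unfolding qop_bases_def sum.empty
  proof (intro conjI ballI allI impI)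
    fix h assume "h \<in> conv_fls" "qop q d (- m) h = 0"
    then show "\<exists>a :: int \<Rightarrow> complex. h = 0" by (simp add: ker)
  next
    fix g assume "g \<in> conv_fls"
    then show "\<exists>h\<in>conv_fls. \<exists>a. g = qop q d (- m) h + (\<Sum>e\<in>{0..<m}. fls_const (a e) * fls_X powi e)"
      by (rule span)
  next
    fix h a e assume h: "h \<in> conv_fls" and e: "e \<in> {0..<m}"
      and eq: "qop q d (- m) h = (\<Sum>e\<in>{0..<m}. fls_const (a e) * fls_X powi e)"
    show "a e = 0" using indep[OF h eq] e by (rule bspec)
  qed simp_all
qed

section \<open>Reduction to a monomial coefficient\<close>

text \<open>Because v(0) = 1, the top term of the convolution moves to the left and gives (q^n - 1)
  w_n = sum of v_(n-i) w_i over i < n. The equation for n = 0 is void, which permits w(0) = 1, and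
  q^n \<noteq> 1 for n > 0.\<close>

lemma gauge_transformation:
  assumes q: "norm q > 1" and v: "fls_subdegree v \<ge> 0" "fls_nth v 0 = 1"
  obtains w where "w \<noteq> 0" "formal_sigma q w = v * w" "v \<in> conv_fls \<Longrightarrow> w \<in> conv_fls"
proof -
  have q0: "q \<noteq> 0" using q by auto
  have qn: "q ^ n \<noteq> 1" if "n > 0" for n
    using powi_inj[OF q, of "int n" 0] that by auto
  define v' where "v' = fls_regpart v"
  have v': "v = fps_to_fls v'" using v(1) by (simp add: v'_def fls_subdegree_ge0I)
  have v'0: "fps_nth v' 0 = 1" using v(2) by (simp add: v'_def)
  obtain f :: "int \<Rightarrow> complex" where f: "\<forall>n\<ge>0. f n = (if n = 0 then 1 else
     (\<Sum>i<nat n. fps_nth v' (nat n - i) * (if int i < n then f (int i) else 0)) / (q ^ nat n - 1))"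
    using int_recursion[of 0 "\<lambda>n f. if n = 0 then 1 else
      (\<Sum>i<nat n. fps_nth v' (nat n - i) * f (int i)) / (q ^ nat n - 1)"] by blast
  define w where "w = Abs_fps (\<lambda>n. f (int n))"
  have w0: "fps_nth w 0 = 1" using f by (simp add: w_def)
  have w: "fps_nth w n = (\<Sum>i<n. fps_nth v' (n - i) * fps_nth w i) / (q ^ n - 1)" if "n > 0" for n
    using f[rule_format, of "int n"] that by (simp add: w_def)
  have rec: "q ^ n * fps_nth w n = fps_nth (v' * w) n" for n
  proof (cases "n = 0")
    case False
    have "fps_nth (v' * w) n = fps_nth (w * v') n" by (simp add: mult.commute)
    also have "\<dots> = (\<Sum>i\<le>n. fps_nth w i * fps_nth v' (n - i))"
      by (simp add: fps_mult_nth atLeast0AtMost)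
    also have "{..n} = insert n {..<n}" by auto
    also have "(\<Sum>i\<in>\<dots>. fps_nth w i * fps_nth v' (n - i)) =
        fps_nth w n + (\<Sum>i<n. fps_nth v' (n - i) * fps_nth w i)"
      by (simp add: v'0 mult.commute)
    also have "(\<Sum>i<n. fps_nth v' (n - i) * fps_nth w i) = fps_nth w n * (q ^ n - 1)"
      using w[of n] qn[of n] False by (simp add: field_simps)
    finally show ?thesis by (simp add: algebra_simps)
  qed (simp add: w0 v'0)
  show ?thesis
  proof (rule that[of "fps_to_fls w"])
    show "fps_to_fls w \<noteq> 0" using w0 by (auto simp: fps_to_fls_eq_0_iff)
    show "formal_sigma q (fps_to_fls w) = v * fps_to_fls w"
    proof (rule fls_eqI)
      fix n
      have "fls_nth (v * fps_to_fls w) n = (if n < 0 then 0 else fps_nth (v' * w) (nat n))"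
        unfolding v' by (simp flip: fls_times_fps_to_fls)
      then show "fls_nth (formal_sigma q (fps_to_fls w)) n = fls_nth (v * fps_to_fls w) n"
        using q0 rec[of "nat n"] by (auto simp: fls_nth_formal_sigma power_int_def)
    qed
  next
    assume "v \<in> conv_fls"
    then obtain C R where CR: "C > 0" "R \<ge> 1" "\<And>n. norm (fls_nth v (int n)) \<le> C * R ^ n"
      unfolding conv_fls_def by (auto elim: fls_conv_radius_posE)
    have Cv: "norm (fps_nth v' n) \<le> C * R ^ n" for n
      using CR(3)[of n] by (simp add: v'_def)
    \<comment> \<open>The recursion sums n terms, each at most C * B * R^n, so preserving B * R^n
      requires C * n \<le> |q^n - 1|, true from some n on.\<close>
    have "(\<lambda>n. real n * (1 / norm q) ^ n) \<longlonglongrightarrow> 0"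
      by (rule powser_times_n_limit_0) (use q q0 in \<open>simp add: divide_less_eq_1_pos\<close>)
    then have "eventually (\<lambda>n. real n * (1 / norm q) ^ n < 1 / (2 * C)) sequentially"
      by (rule order_tendstoD) (use CR in auto)
    moreover have "eventually (\<lambda>n. norm (q ^ n) \<ge> 2) sequentially"
      by (rule eventually_norm_power_ge[OF q])
    ultimately have "eventually (\<lambda>n. n > 0 \<and> C * real n \<le> norm (q ^ n - 1)) sequentially"
      using eventually_gt_at_top[of 0]
    proof eventually_elim
      case (elim n)
      have "norm q ^ n > 0" using q0 by simp
      then have "C * real n \<le> norm (q ^ n) / 2"
        using elim(1) CR(1) by (simp add: field_simps norm_power)
      also have "\<dots> \<le> norm (q ^ n) - 1" using elim(2) by simp
      also have "\<dots> \<le> norm (q ^ n - 1)" using norm_triangle_ineq2[of "q ^ n" 1] by simp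
      finally show ?case using elim(3) by simp
    qed
    then obtain M where M: "\<And>n. n \<ge> M \<Longrightarrow> n > 0 \<and> C * real n \<le> norm (q ^ n - 1)"
      by (auto simp: eventually_at_top_linorder)
    define B where "B = Max (insert 1 ((\<lambda>n. norm (fps_nth w n)) ` {..<M}))"
    have B: "B \<ge> 1" "\<And>n. n < M \<Longrightarrow> norm (fps_nth w n) \<le> B"
      by (auto simp: B_def)
    have "norm (fps_nth w n) \<le> B * R ^ n" for n
    proof (induction n rule: less_induct)
      case (less n)
      show ?case
      proof (cases "n < M")
        case True
        have "norm (fps_nth w n) \<le> B * 1" using B True by auto
        also have "\<dots> \<le> B * R ^ n" using B CR by (intro mult_left_mono) auto
        finally show ?thesis .
      next
        case False
        then have n: "n > 0" "C * real n \<le> norm (q ^ n - 1)" using M by auto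
        have "norm (\<Sum>i<n. fps_nth v' (n - i) * fps_nth w i) \<le> (\<Sum>i<n. C * B * R ^ n)"
        proof (rule sum_norm_le)
          fix i assume i: "i \<in> {..<n}"
          have "norm (fps_nth v' (n - i) * fps_nth w i) \<le> (C * R ^ (n - i)) * (B * R ^ i)"
            unfolding norm_mult using i CR by (intro mult_mono Cv less) auto
          also have "\<dots> = C * B * (R ^ (n - i) * R ^ i)" by (simp add: mult_ac)
          also have "R ^ (n - i) * R ^ i = R ^ n" using i by (simp flip: power_add)
          finally show "norm (fps_nth v' (n - i) * fps_nth w i) \<le> C * B * R ^ n" .
        qed
        also have "\<dots> = (C * real n) * (B * R ^ n)" by simp
        also have "\<dots> \<le> norm (q ^ n - 1) * (B * R ^ n)"
          using n(2) B CR by (intro mult_right_mono) auto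
        finally have "norm (\<Sum>i<n. fps_nth v' (n - i) * fps_nth w i) \<le> norm (q ^ n - 1) * (B * R ^ n)" .
        moreover have "norm (q ^ n - 1) > 0" using qn[OF n(1)] by simp
        ultimately show ?thesis
          unfolding w[OF n(1)] norm_divide by (simp add: pos_divide_le_eq mult.commute)
      qed
    qed
    then show "fps_to_fls w \<in> conv_fls"
      unfolding conv_fls_def mem_Collect_eq
      by (intro fls_conv_radius_posI[of R _ B]) (use CR(2) in auto)
  qed
qed

section \<open>Continuation of local solutions\<close>

text \<open>Read as f(z) = u(z/q) f(z/q) + g(z/q), the equation extends \<open>f\<close> from a disc
  to the disc |q| times as large. These discs exhaust the plane.\<close>

lemma meromorphic_continuation:
  fixes q :: complex
  assumes q: "norm q > 1" and u: "u meromorphic_on UNIV" and g: "g meromorphic_on UNIV"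
    and f: "f meromorphic_on {0}" and eq: "eventually (\<lambda>z. f (q * z) = u z * f z + g z) (at 0)"
  obtains F where "F meromorphic_on UNIV" "eventually (\<lambda>z. F z = f z) (at 0)"
proof -
  have q0: "q \<noteq> 0" using q by auto
  obtain B where B: "open B" "{0} \<subseteq> B" "f meromorphic_on B"
    using f by (rule meromorphic_on_open_nhd)
  from B obtain r1 where r1: "r1 > 0" "ball 0 r1 \<subseteq> B" by (auto simp: open_contains_ball)
  from eq obtain r2 where r2: "r2 > 0" "\<And>z. z \<noteq> 0 \<Longrightarrow> norm z < r2 \<Longrightarrow> f (q * z) = u z * f z + g z"
    by (auto simp: eventually_at dist_norm)
  define r where "r = min r1 r2"
  have r: "r > 0" and f_mero: "f meromorphic_on ball 0 r"
    and f_eq: "\<And>z. z \<noteq> 0 \<Longrightarrow> norm z < r \<Longrightarrow> f (q * z) = u z * f z + g z"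
    using r1 r2 by (auto simp: r_def intro!: meromorphic_on_subset[OF B(3)])
  \<comment> \<open>The k-th extension, to be used on the disc \<open>b k\<close> of radius r
    |q|^k.\<close>
  define s where "s = (\<lambda>k. rec_nat f (\<lambda>_ h z. u (z / q) * h (z / q) + g (z / q)) (k :: nat))"
  have s_0 [simp]: "s 0 = f" and s_Suc: "s (Suc k) = (\<lambda>z. u (z / q) * s k (z / q) + g (z / q))" for k
    by (simp_all add: s_def)
  define b where "b = (\<lambda>k::nat. ball (0::complex) (r * norm q ^ k))"
  have b_div: "z / q \<in> b k" if "z \<in> b (Suc k)" for z k
    using that q0 by (simp add: b_def norm_divide field_simps)
  have b_mono: "b j \<subseteq> b k" if "j \<le> k" for j k
    unfolding b_def using that q r by (intro subset_ball mult_left_mono power_increasing) auto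
  have s_mero: "s k meromorphic_on b k" for k
  proof (induction k)
    case (Suc k)
    have "(\<lambda>z. h (z / q)) meromorphic_on b (Suc k)" if "h meromorphic_on b k" for h
      by (rule meromorphic_on_compose[OF that]) (use b_div q0 in \<open>auto intro!: analytic_intros\<close>)
    then show ?case
      unfolding s_Suc using u g Suc by (intro meromorphic_intros) (auto intro: meromorphic_on_subset)
  qed (use f_mero in \<open>simp add: b_def\<close>)
  have s_eq_Suc: "eventually (\<lambda>w. s (Suc k) w = s k w) (at z)" if "z \<in> b k" for z k
    using that
  proof (induction k arbitrary: z)
    case 0
    have "eventually (\<lambda>w. w \<in> ball 0 r) (at z)"
      using 0 by (intro eventually_at_in_open') (auto simp: b_def)
    moreover have "eventually (\<lambda>w. w \<noteq> 0) (at z)" by (rule eventually_neq_at_within)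
    ultimately show ?case
    proof eventually_elim
      case (elim w)
      have "norm w * 1 \<le> norm w * norm q" using q by (intro mult_left_mono) auto
      then have "norm w / norm q \<le> norm w" using q by (simp add: divide_le_eq)
      then have "norm (w / q) < r" using elim by (simp add: norm_divide)
      with f_eq[of "w / q"] elim q0 show ?case by (simp add: s_Suc)
    qed
  next
    case (Suc k)
    have "eventually (\<lambda>w. s (Suc k) w = s k w) (at (inverse q * z))"
      using Suc.IH[OF b_div[OF Suc.prems]] by (simp add: field_simps)
    then have "eventually (\<lambda>w. s (Suc k) (inverse q * w) = s k (inverse q * w)) (at z)"
      by (rule eventually_at_scale[rotated]) (use q0 in auto)
    then show ?case
      by eventually_elim (simp add: s_Suc[of "Suc k"] s_Suc[of k] divide_inverse mult.commute)
  qed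
  have s_eq: "eventually (\<lambda>w. s k w = s j w) (at z)" if "j \<le> k" "z \<in> b j" for j k z
    using that(1)
  proof (induction k rule: dec_induct)
    case (step k)
    have "z \<in> b k" using that(2) b_mono[OF step.hyps(1)] by auto
    from s_eq_Suc[OF this] step.IH show ?case by eventually_elim simp
  qed simp
  have ex: "\<exists>k. z \<in> b k" for z
  proof -
    obtain k where "norm z / r < norm q ^ k" using real_arch_pow[OF q] by blast
    then show ?thesis using r by (intro exI[of _ k]) (simp add: b_def field_simps)
  qed
  \<comment> \<open>The stages agree only on punctured neighbourhoods. \<open>remove_sings\<close>
    makes the value at a point depend on the punctured germ alone, so the choice of stage no longer
    matters and the stages glue pointwise.\<close>
  define F where "F = (\<lambda>z. remove_sings (s (LEAST k. z \<in> b k)) z)"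
  have F: "F z = remove_sings (s k) z" if "z \<in> b k" for z k
    unfolding F_def
  proof (rule remove_sings_cong)
    have "z \<in> b (LEAST k. z \<in> b k)" using that by (rule LeastI)
    moreover have "(LEAST k. z \<in> b k) \<le> k" using that by (rule Least_le)
    ultimately have "eventually (\<lambda>w. s k w = s (LEAST k. z \<in> b k) w) (at z)" by (intro s_eq)
    then show "eventually (\<lambda>w. s (LEAST k. z \<in> b k) w = s k w) (at z)"
      by eventually_elim simp
  qed simp
  have F_ev: "eventually (\<lambda>w. F w = remove_sings (s k) w) (at z)" if "z \<in> b k" for z k
  proof -
    have "eventually (\<lambda>w. w \<in> b k) (at z)"
      using that by (intro eventually_at_in_open') (auto simp: b_def)
    then show ?thesis by eventually_elim (rule F)
  qed
  have "F meromorphic_on UNIV"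
    unfolding meromorphic_on_def
  proof
    fix z :: complex
    obtain k where k: "z \<in> b k" using ex by blast
    have "F meromorphic_on {z} \<longleftrightarrow> remove_sings (s k) meromorphic_on {z}"
      using F_ev[OF k] by (intro meromorphic_on_cong) auto
    moreover have "remove_sings (s k) meromorphic_on {z}"
      using k by (intro meromorphic_intros meromorphic_on_subset[OF s_mero]) auto
    ultimately show "\<exists>G. (\<lambda>w. F (z + w)) has_laurent_expansion G"
      by (simp add: meromorphic_on_def)
  qed
  moreover have "eventually (\<lambda>z. F z = f z) (at 0)"
  proof -
    have "isolated_singularity_at f 0" using f by (simp add: meromorphic_at_iff)
    then have "eventually (\<lambda>w. remove_sings f w = f w) (at 0)"
      by (rule eventually_remove_sings_eq_at)
    moreover have "0 \<in> b 0" using r by (simp add: b_def)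
    ultimately show ?thesis using F_ev[of 0 0] by (auto elim: eventually_elim2)
  qed
  ultimately show ?thesis by (rule that)
qed

section \<open>Laurent expansion at the origin\<close>

lemma has_laurent_expansion_at_0:
  assumes "f meromorphic_on A" "0 \<in> A"
  shows   "f has_laurent_expansion laurent_expansion f 0"
  using meromorphic_on_imp_has_laurent_expansion[OF assms] by simp

lemma has_laurent_expansion_scale:
  assumes "f has_laurent_expansion F" "q \<noteq> 0"
  shows   "(\<lambda>z. f (q * z)) has_laurent_expansion formal_sigma q F"
proof -
  have "(\<lambda>z. q * z) has_fps_expansion (fps_const q * fps_X)"
    by (intro fps_expansion_intros)
  then have "(\<lambda>z. q * z) has_laurent_expansion fps_to_fls (fps_const q * fps_X)"
    by (rule has_laurent_expansion_fps)
  from has_laurent_expansion_compose[OF assms(1) this] assms(2) show ?thesis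
    by (simp add: formal_sigma_def o_def)
qed

lemma laurent_expansion_mero_rel:
  "mero_rel A f g \<Longrightarrow> 0 \<in> A \<Longrightarrow> laurent_expansion f 0 = laurent_expansion g 0"
  by (rule laurent_expansion_cong) (auto simp: mero_rel_def)

text \<open>The identity theorem: a meromorphic difference on the connected plane is zero, or
  nonzero, off a closed discrete set. It makes the expansion at 0 injective on
  \<open>mero\<close>.\<close>

lemma mero_rel_UNIV_iff:
  assumes "f meromorphic_on UNIV" "g meromorphic_on UNIV"
  shows   "mero_rel UNIV f g \<longleftrightarrow> eventually (\<lambda>z. f z = g z) (at 0)"
proof
  assume ev: "eventually (\<lambda>z. f z = g z) (at 0)"
  have fg: "(\<lambda>z. f z - g z) meromorphic_on UNIV" using assms by (intro meromorphic_intros)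
  have "eventually (\<lambda>z. f z - g z = 0) (cosparse UNIV)"
  proof (rule ccontr)
    assume "\<not> ?thesis"
    then have "eventually (\<lambda>z. f z - g z \<noteq> 0) (cosparse UNIV)"
      using meromorphic_imp_constant_or_avoid[OF fg, of 0] by auto
    then have "eventually (\<lambda>z. f z - g z \<noteq> 0) (at 0)"
      by (auto simp: eventually_cosparse_open_eq)
    with ev have "eventually (\<lambda>z. False) (at (0::complex))" by eventually_elim simp
    then show False by simp
  qed
  then show "mero_rel UNIV f g"
    using assms by (auto simp: mero_rel_def eventually_cosparse_open_eq)
qed (auto simp: mero_rel_def)

lemma laurent_expansion_eq_iff:
  assumes "f meromorphic_on {0}" "g meromorphic_on {0}"
  shows   "laurent_expansion f 0 = laurent_expansion g 0 \<longleftrightarrow> eventually (\<lambda>z. f z = g z) (at 0)"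
proof
  assume "laurent_expansion f 0 = laurent_expansion g 0"
  with has_laurent_expansion_at_0[OF assms(1)] has_laurent_expansion_at_0[OF assms(2)]
  show "eventually (\<lambda>z. f z = g z) (at 0)"
    by (auto simp: has_laurent_expansion_def elim: eventually_elim2)
qed (auto intro: laurent_expansion_cong)

lift_definition mero_fls :: "mero \<Rightarrow> complex fls" is "\<lambda>f. laurent_expansion f 0"
  by (rule laurent_expansion_mero_rel) auto

lift_definition germ_fls :: "mero_germ \<Rightarrow> complex fls" is "\<lambda>f. laurent_expansion f 0"
  by (rule laurent_expansion_mero_rel) auto

lemma mero_fls_add: "mero_fls (x + y) = mero_fls x + mero_fls y"
  by transfer (rule laurent_expansion_0_eqI,
    auto simp: mero_rel_def intro!: laurent_expansion_intros elim!: has_laurent_expansion_at_0)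

lemma mero_fls_mult: "mero_fls (x * y) = mero_fls x * mero_fls y"
  by transfer (rule laurent_expansion_0_eqI,
    auto simp: mero_rel_def intro!: laurent_expansion_intros elim!: has_laurent_expansion_at_0)

lemma mero_fls_const: "mero_fls (mero_const a) = fls_const a"
  by transfer (rule laurent_expansion_0_eqI, rule has_laurent_expansion_const)

lemma mero_fls_z: "mero_fls mero_z = fls_X"
  by transfer (rule laurent_expansion_0_eqI, rule has_laurent_expansion_fps_X)

lemma mero_fls_sigma: "q \<noteq> 0 \<Longrightarrow> mero_fls (mero_sigma q x) = formal_sigma q (mero_fls x)"
  by transfer (rule laurent_expansion_0_eqI,
    auto simp: mero_rel_def intro!: laurent_expansion_intros has_laurent_expansion_scale elim!: has_laurent_expansion_at_0)

lemma germ_fls_add: "germ_fls (x + y) = germ_fls x + germ_fls y"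
  by transfer (rule laurent_expansion_0_eqI,
    auto simp: mero_rel_def intro!: laurent_expansion_intros elim!: has_laurent_expansion_at_0)

lemma germ_fls_mult: "germ_fls (x * y) = germ_fls x * germ_fls y"
  by transfer (rule laurent_expansion_0_eqI,
    auto simp: mero_rel_def intro!: laurent_expansion_intros elim!: has_laurent_expansion_at_0)

lemma germ_fls_const: "germ_fls (germ_const a) = fls_const a"
  by transfer (rule laurent_expansion_0_eqI, rule has_laurent_expansion_const)

lemma germ_fls_z: "germ_fls germ_z = fls_X"
  by transfer (rule laurent_expansion_0_eqI, rule has_laurent_expansion_fps_X)

lemma germ_fls_sigma: "q \<noteq> 0 \<Longrightarrow> germ_fls (germ_sigma q x) = formal_sigma q (germ_fls x)"
  by transfer (rule laurent_expansion_0_eqI,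
    auto simp: mero_rel_def intro!: laurent_expansion_intros has_laurent_expansion_scale elim!: has_laurent_expansion_at_0)

lemma mero_fls_inj: "mero_fls x = mero_fls y \<Longrightarrow> x = y"
proof transfer
  fix f g assume *: "mero_rel UNIV f f" "mero_rel UNIV g g" "laurent_expansion f 0 = laurent_expansion g 0"
  then have "f meromorphic_on UNIV" "g meromorphic_on UNIV" by (auto simp: mero_rel_def)
  with * show "mero_rel UNIV f g"
    by (simp add: mero_rel_UNIV_iff laurent_expansion_eq_iff meromorphic_on_subset[of _ UNIV])
qed

lemma germ_fls_inj: "germ_fls x = germ_fls y \<Longrightarrow> x = y"
  by transfer (auto simp: mero_rel_def laurent_expansion_eq_iff)

lemma germ_fls_conv: "germ_fls x \<in> conv_fls"
  unfolding conv_fls_def mem_Collect_eq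
  by transfer (auto simp: mero_rel_def has_laurent_expansion_def dest: has_laurent_expansion_at_0)

lemma mero_fls_conv: "mero_fls x \<in> conv_fls"
  unfolding conv_fls_def mem_Collect_eq
  by transfer (auto simp: mero_rel_def has_laurent_expansion_def dest: has_laurent_expansion_at_0)

lemma conv_fls_imp_range_germ_fls:
  assumes "h \<in> conv_fls"
  shows   "h \<in> range germ_fls"
proof -
  have h: "eval_fls h has_laurent_expansion h"
    using assms by (intro eval_fls_has_laurent_expansion) (simp add: conv_fls_def)
  then have "eval_fls h meromorphic_on {0}" by (auto simp: meromorphic_on_def)
  then have "\<exists>x. h = germ_fls x"
    using laurent_expansion_0_eqI[OF h]
    by (transfer fixing: h) (auto intro!: exI[of _ "eval_fls h"] mero_rel_refl)
  then show ?thesis by blast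
qed

text \<open>Both sides of the series identity are expansions of functions near 0, so it becomes the
  functional equation that continuation needs.\<close>

lemma range_mero_fls_continuation:
  assumes q: "norm q > 1" and h: "h \<in> conv_fls"
    and eq: "formal_sigma q h = mero_fls u * h + mero_fls g"
  shows   "h \<in> range mero_fls"
proof -
  have q0: "q \<noteq> 0" using q by auto
  define f where "f = eval_fls h"
  have f: "f has_laurent_expansion h"
    unfolding f_def using h by (intro eval_fls_has_laurent_expansion) (simp add: conv_fls_def)
  have "\<exists>x. h = mero_fls x"
    using eq
  proof (transfer fixing: h q)
    fix u g :: "complex \<Rightarrow> complex"
    assume ug: "mero_rel UNIV u u" "mero_rel UNIV g g"
      and eq: "formal_sigma q h = laurent_expansion u 0 * h + laurent_expansion g 0"
    have "(\<lambda>z. f (q * z)) has_laurent_expansion formal_sigma q h"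
      using f q0 by (rule has_laurent_expansion_scale)
    moreover have "(\<lambda>z. u z * f z + g z) has_laurent_expansion formal_sigma q h"
      unfolding eq using ug f
      by (intro laurent_expansion_intros) (auto simp: mero_rel_def elim!: has_laurent_expansion_at_0)
    ultimately have "eventually (\<lambda>z. f (q * z) = u z * f z + g z) (at 0)"
      by (auto simp: has_laurent_expansion_def elim: eventually_elim2)
    moreover have "f meromorphic_on {0}" using f by (auto simp: meromorphic_on_def)
    ultimately obtain F where F: "F meromorphic_on UNIV" "eventually (\<lambda>z. F z = f z) (at 0)"
      using meromorphic_continuation[OF q, of u g f] ug by (auto simp: mero_rel_def)
    have "laurent_expansion F 0 = h"
      using laurent_expansion_cong[OF F(2) refl] laurent_expansion_0_eqI[OF f] by simp
    then show "\<exists>x\<in>{x. mero_rel UNIV x x}. h = laurent_expansion x 0"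
      using F(1) by (auto intro: mero_rel_refl)
  qed
  then show ?thesis by blast
qed

lemma laurent_expansion_tendsto:
  assumes "f meromorphic_on {0}" "f \<midarrow>0\<rightarrow> c"
  shows   "fls_subdegree (laurent_expansion f 0) \<ge> 0" "fls_nth (laurent_expansion f 0) 0 = c"
proof -
  note L = has_laurent_expansion_at_0[OF assms(1) singletonI]
  show *: "fls_subdegree (laurent_expansion f 0) \<ge> 0"
  proof (rule ccontr)
    assume "\<not> ?thesis"
    then have "filterlim f at_infinity (at 0)"
      using has_laurent_expansion_imp_filterlim_infinity_0[OF L] by simp
    then show False
      using not_tendsto_and_filterlim_at_infinity[OF _ assms(2)] by auto
  qed
  from tendsto_unique[OF _ has_laurent_expansion_imp_tendsto_0[OF L *] assms(2)]
  show "fls_nth (laurent_expansion f 0) 0 = c" by auto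
qed

lemma mero_value0_fls:
  "mero_value0 x c \<Longrightarrow> fls_subdegree (mero_fls x) \<ge> 0 \<and> fls_nth (mero_fls x) 0 = c"
  by transfer (use laurent_expansion_tendsto meromorphic_on_subset[of _ UNIV "{0}"] in
    \<open>auto simp: mero_rel_def\<close>)

lemma germ_value0_fls:
  "germ_value0 x c \<Longrightarrow> fls_subdegree (germ_fls x) \<ge> 0 \<and> fls_nth (germ_fls x) 0 = c"
  by transfer (use laurent_expansion_tendsto in \<open>auto simp: mero_rel_def\<close>)

section \<open>Subfields closed under solutions\<close>

lemma formal_sigma_mult: "q \<noteq> 0 \<Longrightarrow> formal_sigma q (f * g) = formal_sigma q f * formal_sigma q g"
  unfolding formal_sigma_def by (rule fls_compose_fps_mult) auto

lemma formal_sigma_add: "q \<noteq> 0 \<Longrightarrow> formal_sigma q (f + g) = formal_sigma q f + formal_sigma q g"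
  unfolding formal_sigma_def by (rule fls_compose_fps_add) auto

lemma formal_sigma_const: "formal_sigma q (fls_const a) = fls_const a"
  by (simp add: formal_sigma_def)

lemma conv_fls_add: "f \<in> conv_fls \<Longrightarrow> g \<in> conv_fls \<Longrightarrow> f + g \<in> conv_fls"
  and conv_fls_mult: "f \<in> conv_fls \<Longrightarrow> g \<in> conv_fls \<Longrightarrow> f * g \<in> conv_fls"
  using fls_conv_radius_add[of f g] fls_conv_radius_mult[of f g]
  by (auto simp: conv_fls_def min_def split: if_splits)

text \<open>The inverse of the sum function has the inverse series as its expansion, and expansions
  converge.\<close>

lemma conv_fls_inverse: "f \<in> conv_fls \<Longrightarrow> inverse f \<in> conv_fls"
  using has_laurent_expansion_inverse[OF eval_fls_has_laurent_expansion[of f]]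
  by (auto simp: conv_fls_def has_laurent_expansion_def)

text \<open>The equations are solved in \<open>D\<close>, which may be larger than the image of the field under
  study; the last assumption brings the solutions back.\<close>

locale q_field =
  fixes c :: "complex \<Rightarrow> 'a::field" and Z :: 'a and \<sigma> :: "'a \<Rightarrow> 'a"
    and \<phi> :: "'a \<Rightarrow> complex fls" and q :: complex and D :: "complex fls set"
  assumes q: "norm q > 1"
    and \<phi>_add: "\<phi> (x + y) = \<phi> x + \<phi> y"
    and \<phi>_mult: "\<phi> (x * y) = \<phi> x * \<phi> y"
    and \<phi>_inj: "\<phi> x = \<phi> y \<Longrightarrow> x = y"
    and \<phi>_c: "\<phi> (c a) = fls_const a"
    and \<phi>_Z: "\<phi> Z = fls_X"
    and \<phi>_\<sigma>: "\<phi> (\<sigma> x) = formal_sigma q (\<phi> x)"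
    and \<phi>_D: "\<phi> x \<in> D"
    and D: "D = UNIV \<or> D = conv_fls"
    and solution_in_K: "h \<in> D \<Longrightarrow> formal_sigma q h = \<phi> u * h + \<phi> g \<Longrightarrow> h \<in> range \<phi>"
begin

lemma q0: "q \<noteq> 0" using q by auto

lemma \<phi>_0 [simp]: "\<phi> 0 = 0"
  using \<phi>_add[of 0 0] by (metis add_cancel_right_right)

lemma \<phi>_diff: "\<phi> (x - y) = \<phi> x - \<phi> y"
  using \<phi>_add[of "x - y" y] by simp

lemma \<phi>_eq_0_iff [simp]: "\<phi> x = 0 \<longleftrightarrow> x = 0"
  using \<phi>_inj[of x 0] by auto

lemma \<phi>_1 [simp]: "\<phi> 1 = 1"
  using \<phi>_mult[of 1 1] \<phi>_eq_0_iff[of 1] by (metis mult_cancel_right1 mult_1 one_neq_zero)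

lemma \<phi>_inverse: "\<phi> (inverse x) = inverse (\<phi> x)"
proof (cases "x = 0")
  case False
  then have "\<phi> x * \<phi> (inverse x) = 1" by (simp flip: \<phi>_mult)
  then show ?thesis by (metis inverse_unique)
qed simp

lemma \<phi>_power: "\<phi> (x ^ n) = \<phi> x ^ n"
  by (induction n) (simp_all add: \<phi>_mult)

lemma \<phi>_powi: "\<phi> (x powi n) = \<phi> x powi n"
  by (simp add: power_int_def \<phi>_power \<phi>_inverse)

lemma \<phi>_sum: "\<phi> (sum f E) = (\<Sum>e\<in>E. \<phi> (f e))"
  by (induction E rule: infinite_finite_induct) (simp_all add: \<phi>_add)

lemma D_add: "f \<in> D \<Longrightarrow> g \<in> D \<Longrightarrow> f + g \<in> D"
  and D_mult: "f \<in> D \<Longrightarrow> g \<in> D \<Longrightarrow> f * g \<in> D"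
  and D_inverse: "f \<in> D \<Longrightarrow> inverse f \<in> D"
  using D conv_fls_add conv_fls_mult conv_fls_inverse by auto

lemma vs: "vectorspace class_ring (cspace c)"
  by (rule vectorspace_cspace; rule \<phi>_inj)
     (simp_all add: \<phi>_c \<phi>_add \<phi>_mult fls_plus_const fls_const_mult_const)

text \<open>The substitution f = w h turns the operator into \<open>v * w\<close> times
  \<open>qop\<close>. Kernel monomials thus acquire the factor \<open>w\<close> and complement
  monomials the factor \<open>v * w\<close>; both stay in the field because \<open>w\<close> does.
  Injectivity of \<open>\<phi>\<close> allows every identity to be checked on series.\<close>

lemma index_if_qop_bases:
  fixes d :: complex and \<nu> :: int and v :: 'a
  defines "T \<equiv> \<lambda>f. \<sigma> f - c d * Z powi \<nu> * v * f"
  assumes v: "fls_subdegree (\<phi> v) \<ge> 0" "fls_nth (\<phi> v) 0 = 1"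
    and bases: "qop_bases D q d \<nu> E E'"
  shows "has_index (cspace c) T" "dim_ker (cspace c) T = card E" "dim_coker (cspace c) T = card E'"
proof -
  have v0: "v \<noteq> 0" using v(2) by auto
  have \<phi>T: "\<phi> (T f) = formal_sigma q (\<phi> f) - fls_const d * fls_X powi \<nu> * \<phi> v * \<phi> f" for f
    by (simp add: T_def \<phi>_diff \<phi>_mult \<phi>_\<sigma> \<phi>_c \<phi>_powi \<phi>_Z)
  interpret T: cspace_op c T
  proof (rule cspace_op.intro)
    fix x y a
    show "vectorspace class_ring (cspace c)" by (rule vs)
    show "T (x + y) = T x + T y"
      by (rule \<phi>_inj) (simp add: \<phi>T \<phi>_add formal_sigma_add q0 algebra_simps)
    show "T (c a * x) = c a * T x"
      by (rule \<phi>_inj)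
        (simp add: \<phi>T \<phi>_mult \<phi>_c formal_sigma_mult formal_sigma_const q0 algebra_simps)
  qed
  obtain w where w: "w \<noteq> 0" "formal_sigma q w = \<phi> v * w" "\<phi> v \<in> conv_fls \<Longrightarrow> w \<in> conv_fls"
    by (rule gauge_transformation[OF q v]) (rule that)
  have wD: "w \<in> D" using D w(3) \<phi>_D[of v] by auto
  \<comment> \<open>The gauge factor solves the homogeneous equation with coefficient
    \<open>v\<close>, so the closure property applies to it.\<close>
  have "w \<in> range \<phi>" by (rule solution_in_K[OF wD, of v 0]) (simp add: w(2))
  then obtain W where W: "w = \<phi> W" by auto
  have gauge: "formal_sigma q (w * h) - fls_const d * fls_X powi \<nu> * \<phi> v * (w * h) =
      \<phi> v * w * qop q d \<nu> h" for h
    by (simp add: formal_sigma_mult[OF q0] w(2) qop_def algebra_simps)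
  have T_gauge: "\<phi> (T f) = \<phi> v * w * qop q d \<nu> h" if "\<phi> f = w * h" for f h
    unfolding \<phi>T that by (rule gauge)
  have div_w: "\<phi> f = w * (\<phi> f * inverse w)" "\<phi> f * inverse w \<in> D" for f
    using w(1) wD by (auto intro!: D_mult D_inverse \<phi>_D)
  have X_eq_iff: "(fls_X powi e :: complex fls) = fls_X powi e' \<longleftrightarrow> e = e'" for e e'
    by (metis nth_X_powi one_neq_zero)

  define \<beta> where "\<beta> = (\<lambda>e. W * Z powi e)"
  define \<beta>' where "\<beta>' = (\<lambda>e. v * W * Z powi e)"
  have \<phi>\<beta>: "\<phi> (\<beta> e) = w * fls_X powi e" and \<phi>\<beta>': "\<phi> (\<beta>' e) = \<phi> v * w * fls_X powi e" for e
    by (simp_all add: \<beta>_def \<beta>'_def \<phi>_mult \<phi>_powi \<phi>_Z W)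
  have inj: "inj_on \<beta> E" "inj_on \<beta>' E'"
    using w(1) v0 X_eq_iff by (auto intro!: inj_onI dest!: arg_cong[of _ _ \<phi>] simp: \<phi>\<beta> \<phi>\<beta>')
  have \<phi>_sum\<beta>: "\<phi> (\<Sum>e\<in>E. c (a e) * \<beta> e) = w * (\<Sum>e\<in>E. fls_const (a e) * fls_X powi e)" for a
    by (simp add: \<phi>_sum \<phi>_mult \<phi>_c \<phi>\<beta> sum_distrib_left mult_ac)
  have \<phi>_sum\<beta>': "\<phi> (\<Sum>e\<in>E'. c (a e) * \<beta>' e) =
      \<phi> v * w * (\<Sum>e\<in>E'. fls_const (a e) * fls_X powi e)" for a
    by (simp add: \<phi>_sum \<phi>_mult \<phi>_c \<phi>\<beta>' sum_distrib_left mult_ac)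
  have fin: "finite E" "finite E'"
    using bases by (simp_all add: qop_bases_def)

  have ker_mem: "T (\<beta> e) = 0" if "e \<in> E" for e
  proof -
    have "qop q d \<nu> (fls_X powi e) = 0" using bases that by (simp add: qop_bases_def)
    then have "\<phi> (T (\<beta> e)) = 0" using T_gauge[OF \<phi>\<beta>] by simp
    then show ?thesis by simp
  qed
  have ker_span: "\<exists>a. x = (\<Sum>e\<in>E. c (a e) * \<beta> e)" if "T x = 0" for x
  proof -
    have "qop q d \<nu> (\<phi> x * inverse w) = 0"
      using T_gauge[OF div_w(1)[of x]] that v0 w(1) by simp
    with div_w(2)[of x] bases
    obtain a where a: "\<phi> x * inverse w = (\<Sum>e\<in>E. fls_const (a e) * fls_X powi e)"
      unfolding qop_bases_def by meson
    have "\<phi> x = \<phi> (\<Sum>e\<in>E. c (a e) * \<beta> e)"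
      unfolding \<phi>_sum\<beta> a[symmetric] by (rule div_w(1))
    then show ?thesis by (blast dest: \<phi>_inj)
  qed
  have ker_indep: "\<forall>e\<in>E. a e = 0" if "(\<Sum>e\<in>E. c (a e) * \<beta> e) = 0" for a
  proof -
    have "w * (\<Sum>e\<in>E. fls_const (a e) * fls_X powi e) = 0"
      unfolding \<phi>_sum\<beta>[symmetric] using that by simp
    then have "(\<Sum>e\<in>E. fls_const (a e) * fls_X powi e) = 0" using w(1) by simp
    then show ?thesis
      using nth_sum_const_X_powi[OF fin(1), of a] by (metis fls_zero_nth)
  qed
  note ker = T.ker_space_family[OF fin(1) inj(1) ker_mem ker_span ker_indep]

  have coker_span: "\<exists>f a. g = T f + (\<Sum>e\<in>E'. c (a e) * \<beta>' e)" for g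
  proof -
    define g' where "g' = \<phi> g * inverse (\<phi> v * w)"
    have g': "\<phi> g = \<phi> v * w * g'" using w(1) v0 by (simp add: g'_def field_simps)
    have "g' \<in> D" unfolding g'_def by (intro D_mult D_inverse \<phi>_D wD)
    with bases obtain h a where h: "h \<in> D"
      and eq: "g' = qop q d \<nu> h + (\<Sum>e\<in>E'. fls_const (a e) * fls_X powi e)"
      unfolding qop_bases_def by meson
    define r where "r = (\<Sum>e\<in>E'. c (a e) * \<beta>' e)"
    have r: "\<phi> g = \<phi> v * w * qop q d \<nu> h + \<phi> r"
      unfolding g' eq r_def \<phi>_sum\<beta>' by (simp only: distrib_left)
    \<comment> \<open>\<open>h\<close> is known only to lie in \<open>D\<close>. The product
      \<open>w * h\<close> solves the original equation with inhomogeneity \<open>g - r\<close>, an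
      element of the field, and is brought back by closure.\<close>
    have "w * h \<in> range \<phi>"
    proof (rule solution_in_K)
      show "w * h \<in> D" by (intro D_mult wD h)
      have "\<phi> (c d * Z powi \<nu> * v) = fls_const d * fls_X powi \<nu> * \<phi> v"
        by (simp add: \<phi>_mult \<phi>_powi \<phi>_Z \<phi>_c)
      with gauge[of h] r show "formal_sigma q (w * h) = \<phi> (c d * Z powi \<nu> * v) * (w * h) + \<phi> (g - r)"
        by (simp add: \<phi>_diff algebra_simps)
    qed
    then obtain f where f: "\<phi> f = w * h" by auto
    have "\<phi> g = \<phi> (T f + r)" unfolding \<phi>_add T_gauge[OF f] by (rule r)
    then show ?thesis unfolding r_def by (blast dest: \<phi>_inj)
  qed
  have coker_indep: "\<forall>e\<in>E'. a e = 0" if "T f = (\<Sum>e\<in>E'. c (a e) * \<beta>' e)" for f a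
  proof -
    have "\<phi> v * w * qop q d \<nu> (\<phi> f * inverse w) =
        \<phi> v * w * (\<Sum>e\<in>E'. fls_const (a e) * fls_X powi e)"
      unfolding T_gauge[OF div_w(1), symmetric] that by (rule \<phi>_sum\<beta>')
    then have "qop q d \<nu> (\<phi> f * inverse w) = (\<Sum>e\<in>E'. fls_const (a e) * fls_X powi e)"
      using v0 w(1) by simp
    with div_w(2)[of f] bases show ?thesis unfolding qop_bases_def by meson
  qed
  note coker = T.coker_space_family[OF fin(2) inj(2) coker_span coker_indep]

  show "has_index (cspace c) T" "dim_ker (cspace c) T = card E" "dim_coker (cspace c) T = card E'"
    using ker coker T.T.linear_map_axioms by (simp_all add: has_index_def)
qed

lemma index_table:
  fixes d :: complex and \<nu> :: int and v :: 'a
  defines "T \<equiv> \<lambda>f. \<sigma> f - c d * Z powi \<nu> * v * f"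
  assumes d: "d \<noteq> 0" and v: "fls_subdegree (\<phi> v) \<ge> 0 \<and> fls_nth (\<phi> v) 0 = 1"
  shows "has_index (cspace c) T"
    and "\<nu> = 0 \<and> (\<exists>k::int. d = q powi k) \<longrightarrow>
           dim_ker (cspace c) T = 1 \<and> dim_coker (cspace c) T = 1 \<and> op_index (cspace c) T = 0"
    and "\<nu> = 0 \<and> \<not> (\<exists>k::int. d = q powi k) \<longrightarrow>
           dim_ker (cspace c) T = 0 \<and> dim_coker (cspace c) T = 0 \<and> op_index (cspace c) T = 0"
    and "\<nu> > 0 \<longrightarrow>
           dim_ker (cspace c) T = 0 \<and> dim_coker (cspace c) T = 0 \<and> op_index (cspace c) T = 0"
    and "D = UNIV \<Longrightarrow> \<nu> < 0 \<longrightarrow>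
           dim_ker (cspace c) T = 0 \<and> dim_coker (cspace c) T = 0 \<and> op_index (cspace c) T = 0"
    and "D = conv_fls \<Longrightarrow> \<nu> < 0 \<longrightarrow>
           dim_ker (cspace c) T = 0 \<and> dim_coker (cspace c) T = nat (- \<nu>) \<and> op_index (cspace c) T = \<nu>"
proof -
  have idx: "has_index (cspace c) T \<and> dim_ker (cspace c) T = card E \<and> dim_coker (cspace c) T = card E'"
    if "qop_bases D q d \<nu> E E'" for E E'
    using index_if_qop_bases[of v d \<nu> E E'] v that unfolding T_def by blast
  have res: "qop_bases D q d \<nu> {k} {k}" if "\<nu> = 0" "d = q powi k" for k
    using qop_bases_0_resonant[OF q that(2) D] that(1) by simp
  have nonres: "qop_bases D q d \<nu> {} {}" if "\<nu> = 0" "\<not> (\<exists>k::int. d = q powi k)"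
    using qop_bases_0_nonresonant[OF q that(2) D] that(1) by simp
  have pos: "qop_bases D q d \<nu> {} {}" if "\<nu> > 0"
    by (rule qop_bases_pos[OF q d that D])
  have neg: "qop_bases D q d \<nu> {} {}" if "\<nu> < 0" "D = UNIV"
    unfolding that(2) by (rule qop_bases_neg_formal[OF q d that(1)])
  have neg': "qop_bases D q d \<nu> {} {0..<- \<nu>}" if "\<nu> < 0" "D = conv_fls"
    unfolding that(2) using qop_bases_neg_conv[OF q d, of "- \<nu>"] that(1) by simp
  consider "\<nu> = 0" "\<exists>k::int. d = q powi k" | "\<nu> = 0" "\<not> (\<exists>k::int. d = q powi k)" | "\<nu> > 0"
    | "\<nu> < 0" "D = UNIV" | "\<nu> < 0" "D = conv_fls"
    using D linorder_less_linear[of \<nu> 0] by blast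
  then show "has_index (cspace c) T"
    by cases (use idx res nonres pos neg neg' in blast)+
  show "\<nu> = 0 \<and> (\<exists>k::int. d = q powi k) \<longrightarrow>
           dim_ker (cspace c) T = 1 \<and> dim_coker (cspace c) T = 1 \<and> op_index (cspace c) T = 0"
  proof (intro impI, elim conjE exE)
    fix k :: int assume "\<nu> = 0" "d = q powi k"
    from idx[OF res[OF this]] show "dim_ker (cspace c) T = 1 \<and> dim_coker (cspace c) T = 1 \<and> op_index (cspace c) T = 0"
      by (simp add: op_index_def)
  qed
  show "\<nu> = 0 \<and> \<not> (\<exists>k::int. d = q powi k) \<longrightarrow>
           dim_ker (cspace c) T = 0 \<and> dim_coker (cspace c) T = 0 \<and> op_index (cspace c) T = 0"
    using idx[OF nonres] by (simp add: op_index_def)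
  show "\<nu> > 0 \<longrightarrow>
           dim_ker (cspace c) T = 0 \<and> dim_coker (cspace c) T = 0 \<and> op_index (cspace c) T = 0"
    using idx[OF pos] by (simp add: op_index_def)
  show "\<nu> < 0 \<longrightarrow>
           dim_ker (cspace c) T = 0 \<and> dim_coker (cspace c) T = 0 \<and> op_index (cspace c) T = 0" if "D = UNIV"
    using idx[OF neg] that by (simp add: op_index_def)
  show "\<nu> < 0 \<longrightarrow>
           dim_ker (cspace c) T = 0 \<and> dim_coker (cspace c) T = nat (- \<nu>) \<and> op_index (cspace c) T = \<nu>" if "D = conv_fls"
    using idx[OF neg'] that by (simp add: op_index_def)
qed

end

section \<open>The three fields and the resulting index table\<close>

text \<open>The convergent series properly contain the expansions of functions meromorphic on the
  plane; the closure property is supplied by continuation.\<close>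

lemma q_field_mero:
  assumes "norm q > 1"
  shows   "q_field mero_const mero_z (mero_sigma q) mero_fls q conv_fls"
proof
  have q0: "q \<noteq> 0" using assms by auto
  fix x y u g :: mero and h a
  show "mero_fls (mero_sigma q x) = formal_sigma q (mero_fls x)" using q0 by (rule mero_fls_sigma)
  show "h \<in> range mero_fls" if "h \<in> conv_fls" "formal_sigma q h = mero_fls u * h + mero_fls g"
    using assms that by (rule range_mero_fls_continuation)
  show "x = y" if "mero_fls x = mero_fls y" using that by (rule mero_fls_inj)
qed (use assms in \<open>simp_all add: mero_fls_add mero_fls_mult mero_fls_const mero_fls_z mero_fls_conv\<close>)

text \<open>Every convergent series is the expansion of a germ, so closure holds whatever equation
  the series solves.\<close>

lemma q_field_germ:
  assumes "norm q > 1"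
  shows   "q_field germ_const germ_z (germ_sigma q) germ_fls q conv_fls"
proof
  have q0: "q \<noteq> 0" using assms by auto
  fix x y :: mero_germ and h a
  show "germ_fls (germ_sigma q x) = formal_sigma q (germ_fls x)" using q0 by (rule germ_fls_sigma)
  show "h \<in> range germ_fls" if "h \<in> conv_fls" using that by (rule conv_fls_imp_range_germ_fls)
  show "x = y" if "germ_fls x = germ_fls y" using that by (rule germ_fls_inj)
qed (use assms in \<open>simp_all add: germ_fls_add germ_fls_mult germ_fls_const germ_fls_z germ_fls_conv\<close>)

lemma q_field_formal:
  assumes "norm q > 1"
  shows   "q_field fls_const fls_X (formal_sigma q) (\<lambda>f. f) q UNIV"
  by unfold_locales (use assms in simp_all)

theorem proposition4p9:
  fixes q d :: complex and \<nu> :: int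
  assumes "norm q > 1" and "d \<noteq> 0"
  shows
   "(\<forall>v :: mero. mero_value0 v 1 \<longrightarrow>
      (let V = cspace mero_const;
           u = mero_const d * mero_z powi \<nu> * v;
           T = (\<lambda>f. mero_sigma q f - u * f)
       in has_index V T \<and>
          (\<nu> = 0 \<and> (\<exists>k::int. d = q powi k) \<longrightarrow>
             dim_ker V T = 1 \<and> dim_coker V T = 1 \<and> op_index V T = 0) \<and>
          (\<nu> = 0 \<and> \<not> (\<exists>k::int. d = q powi k) \<longrightarrow>
             dim_ker V T = 0 \<and> dim_coker V T = 0 \<and> op_index V T = 0) \<and>
          (\<nu> > 0 \<longrightarrow>
             dim_ker V T = 0 \<and> dim_coker V T = 0 \<and> op_index V T = 0) \<and>
          (\<nu> < 0 \<longrightarrow>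
             dim_ker V T = 0 \<and> dim_coker V T = nat (- \<nu>) \<and> op_index V T = \<nu>))) \<and>
    (\<forall>v :: mero_germ. germ_value0 v 1 \<longrightarrow>
      (let V = cspace germ_const;
           u = germ_const d * germ_z powi \<nu> * v;
           T = (\<lambda>f. germ_sigma q f - u * f)
       in has_index V T \<and>
          (\<nu> = 0 \<and> (\<exists>k::int. d = q powi k) \<longrightarrow>
             dim_ker V T = 1 \<and> dim_coker V T = 1 \<and> op_index V T = 0) \<and>
          (\<nu> = 0 \<and> \<not> (\<exists>k::int. d = q powi k) \<longrightarrow>
             dim_ker V T = 0 \<and> dim_coker V T = 0 \<and> op_index V T = 0) \<and>
          (\<nu> > 0 \<longrightarrow>
             dim_ker V T = 0 \<and> dim_coker V T = 0 \<and> op_index V T = 0) \<and>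
          (\<nu> < 0 \<longrightarrow>
             dim_ker V T = 0 \<and> dim_coker V T = nat (- \<nu>) \<and> op_index V T = \<nu>))) \<and>
    (\<forall>v :: complex fls. formal_value0 v 1 \<longrightarrow>
      (let V = cspace fls_const;
           u = fls_const d * fls_X powi \<nu> * v;
           T = (\<lambda>f. formal_sigma q f - u * f)
       in has_index V T \<and>
          (\<nu> = 0 \<and> (\<exists>k::int. d = q powi k) \<longrightarrow>
             dim_ker V T = 1 \<and> dim_coker V T = 1 \<and> op_index V T = 0) \<and>
          (\<nu> = 0 \<and> \<not> (\<exists>k::int. d = q powi k) \<longrightarrow>
             dim_ker V T = 0 \<and> dim_coker V T = 0 \<and> op_index V T = 0) \<and>
          (\<nu> > 0 \<longrightarrow>
             dim_ker V T = 0 \<and> dim_coker V T = 0 \<and> op_index V T = 0) \<and>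
          (\<nu> < 0 \<longrightarrow>
             dim_ker V T = 0 \<and> dim_coker V T = 0 \<and> op_index V T = 0)))"
proof (intro conjI allI impI)
  fix v :: mero assume v: "mero_value0 v 1"
  note t = q_field.index_table[OF q_field_mero[OF assms(1)] assms(2) mero_value0_fls[OF v]]
  show "let V = cspace mero_const; u = mero_const d * mero_z powi \<nu> * v;
          T = (\<lambda>f. mero_sigma q f - u * f)
       in has_index V T \<and>
          (\<nu> = 0 \<and> (\<exists>k::int. d = q powi k) \<longrightarrow>
             dim_ker V T = 1 \<and> dim_coker V T = 1 \<and> op_index V T = 0) \<and>
          (\<nu> = 0 \<and> \<not> (\<exists>k::int. d = q powi k) \<longrightarrow>
             dim_ker V T = 0 \<and> dim_coker V T = 0 \<and> op_index V T = 0) \<and>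
          (\<nu> > 0 \<longrightarrow>
             dim_ker V T = 0 \<and> dim_coker V T = 0 \<and> op_index V T = 0) \<and>
          (\<nu> < 0 \<longrightarrow>
             dim_ker V T = 0 \<and> dim_coker V T = nat (- \<nu>) \<and> op_index V T = \<nu>)"
    unfolding Let_def
    by (rule conjI[OF t(1) conjI[OF t(2) conjI[OF t(3) conjI[OF t(4) t(6)[OF refl]]]]])
next
  fix v :: mero_germ assume v: "germ_value0 v 1"
  note t = q_field.index_table[OF q_field_germ[OF assms(1)] assms(2) germ_value0_fls[OF v]]
  show "let V = cspace germ_const; u = germ_const d * germ_z powi \<nu> * v;
          T = (\<lambda>f. germ_sigma q f - u * f)
       in has_index V T \<and>
          (\<nu> = 0 \<and> (\<exists>k::int. d = q powi k) \<longrightarrow>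
             dim_ker V T = 1 \<and> dim_coker V T = 1 \<and> op_index V T = 0) \<and>
          (\<nu> = 0 \<and> \<not> (\<exists>k::int. d = q powi k) \<longrightarrow>
             dim_ker V T = 0 \<and> dim_coker V T = 0 \<and> op_index V T = 0) \<and>
          (\<nu> > 0 \<longrightarrow>
             dim_ker V T = 0 \<and> dim_coker V T = 0 \<and> op_index V T = 0) \<and>
          (\<nu> < 0 \<longrightarrow>
             dim_ker V T = 0 \<and> dim_coker V T = nat (- \<nu>) \<and> op_index V T = \<nu>)"
    unfolding Let_def
    by (rule conjI[OF t(1) conjI[OF t(2) conjI[OF t(3) conjI[OF t(4) t(6)[OF refl]]]]])
next
  fix v :: "complex fls" assume v: "formal_value0 v 1"
  have v': "fls_subdegree v \<ge> 0 \<and> fls_nth v 0 = 1"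
    using v by (simp add: formal_value0_def)
  have qf: "q_field fls_const fls_X (formal_sigma q) (\<lambda>f. f) q UNIV"
    using assms(1) by (rule q_field_formal)
  note t = q_field.index_table[OF qf, OF assms(2) v']
  show "let V = cspace fls_const; u = fls_const d * fls_X powi \<nu> * v;
          T = (\<lambda>f. formal_sigma q f - u * f)
       in has_index V T \<and>
          (\<nu> = 0 \<and> (\<exists>k::int. d = q powi k) \<longrightarrow>
             dim_ker V T = 1 \<and> dim_coker V T = 1 \<and> op_index V T = 0) \<and>
          (\<nu> = 0 \<and> \<not> (\<exists>k::int. d = q powi k) \<longrightarrow>
             dim_ker V T = 0 \<and> dim_coker V T = 0 \<and> op_index V T = 0) \<and>
          (\<nu> > 0 \<longrightarrow>
             dim_ker V T = 0 \<and> dim_coker V T = 0 \<and> op_index V T = 0) \<and>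
          (\<nu> < 0 \<longrightarrow>
             dim_ker V T = 0 \<and> dim_coker V T = 0 \<and> op_index V T = 0)"
    unfolding Let_def
    by (rule conjI[OF t(1) conjI[OF t(2) conjI[OF t(3) conjI[OF t(4) t(5)[OF refl]]]]])
qed

end
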